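(* For all integers $n\ge 0$: (a) $p_{R,D}^{(3,3)}(4n+2)\equiv 0 \pmod 2$; (b) $p_{R,D}^{(2,5)}(4n+3)\equiv 0 \pmod 2$; (c) $\sum_{n=0}^\infty p_{R,D}^{(2,5)}(4n+1)\,q^n\equiv \prod_{m=1}^\infty(1-q^{5m}) \pmod 2$, meaning that the coefficients of $q^n$ on the two sides are congruent modulo $2$ for every $n$.
   Context: For integers $s,t\ge 2$, $p_{R,D}^{(s,t)}(n)$ denotes the number of partitions of $n$ in which no part is divisible by $s$ and no part appears $t$ or more times. *)

theory Defs
  imports
    "HOL-Analysis.Infinite_Products"
    "HOL-Computational_Algebra.Formal_Power_Series"
    "HOL-Library.Multiset"
    "HOL-Number_Theory.Cong"
begin

definition int_partitions :: "nat \<Rightarrow> nat multiset set" where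
  "int_partitions n = {P. 0 \<notin># P \<and> sum_mset P = n}"

definition p_RD :: "nat \<Rightarrow> nat \<Rightarrow> nat \<Rightarrow> nat" where
  "p_RD s t n =
    card {P \<in> int_partitions n. (\<forall>k \<in># P. \<not> s dvd k) \<and> (\<forall>k \<in># P. \<not> count P k \<ge> t)}"

end

theory Submission
  imports
    Defs
    "HOL-Library.Z2"
    "HOL-Library.Disjoint_Sets"
    "HOL-Library.FuncSet"
    "HOL-Computational_Algebra.Formal_Laurent_Series"
begin

text \<open>Over the field with two elements the signs in the triple product vanish, so a
  coefficient of a product of two theta series is the parity of the number of lattice points with a
  given value of a quadratic form. A form-preserving involution leaves only its fixed points; these
  lie on lines, along which the form is again the weight of a theta series. The identity for f_1^3
  alone needs no involution, only the residues of the index modulo 3. For f_1 f_5 the obstacle is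
  that the two pentagonal series lead to u^2 + 5 v^2, whose only integral symmetries are sign
  changes. Regrouping the factors as \<open>theta 1 4 * theta 2 3\<close> leads to x^2 + y^2
  instead. Even there one class modulo 5 has no suitable involution: it reproduces the whole product
  at q^5. The identity therefore comes from uniqueness of the solution of F = P + q F(q^5). The
  multipliers f_4 f_36 = (f_1 f_9)^4 and f_20 = f_5^4 clear the denominators of G while being series
  in q^4, so they do not mix the residue classes of exponents and can be cancelled
  afterwards.\<close>

text \<open>
  Write f_k for the product of 1 - q^(km) over m at least 1, taken over the field with two elements,
  so that f_k^2 = f_2k. The generating function of p_RD s t is G = f_s f_t / (f_1 f_st).

  The Jacobi triple product turns f_k, f_k^3 and f_1 f_5 into theta series, and norm-preserving
  involutions on the summation indices (units of the Eisenstein and Gaussian integers) give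
    f_1^3 = f_3 + q f_9^3,  f_1^3 f_3^3 = f_4^3 + q f_12^3,  f_1 f_5 = f_2^3 + q f_10^3.

  For (s, t) = (3, 3) these yield q G f_4 f_36 = f_2 f_4 f_6 + f_4^3 + q f_12^3, and comparing exponents
  congruent to 3 modulo 4 gives (a). For (s, t) = (2, 5) they yield G f_20 = f_2^3 f_10 + q f_20^2,
  so the odd part of G is q f_20, which gives (b) and (c).
\<close>

section \<open>Formal power series and infinite products\<close>

definition eq_upto :: "nat \<Rightarrow> 'a::zero fps \<Rightarrow> 'a fps \<Rightarrow> bool" where
  "eq_upto m f g \<longleftrightarrow> (\<forall>n<m. fps_nth f n = fps_nth g n)"

lemma eq_upto_refl [simp]: "eq_upto m f f"
  by (simp add: eq_upto_def)

lemma eq_upto_sym: "eq_upto m f g \<Longrightarrow> eq_upto m g f"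
  by (simp add: eq_upto_def)

lemma eq_upto_trans: "eq_upto m f g \<Longrightarrow> eq_upto m g h \<Longrightarrow> eq_upto m f h"
  by (simp add: eq_upto_def)

lemma eq_upto_mono: "eq_upto m f g \<Longrightarrow> k \<le> m \<Longrightarrow> eq_upto k f g"
  by (simp add: eq_upto_def)

lemma eq_upto_mult:
  fixes f g f' g' :: "'a::comm_ring_1 fps"
  shows "eq_upto m f g \<Longrightarrow> eq_upto m f' g' \<Longrightarrow> eq_upto m (f * f') (g * g')"
  by (auto simp: eq_upto_def fps_mult_nth intro!: sum.cong)

lemma eq_upto_prod:
  fixes f g :: "'b \<Rightarrow> 'a::comm_ring_1 fps"
  shows "(\<And>i. i \<in> A \<Longrightarrow> eq_upto m (f i) (g i)) \<Longrightarrow> eq_upto m (\<Prod>i\<in>A. f i) (\<Prod>i\<in>A. g i)"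
  by (induction A rule: infinite_finite_induct) (auto intro!: eq_upto_mult)

lemma eq_upto_prod_1:
  fixes f :: "'b \<Rightarrow> 'a::comm_ring_1 fps"
  shows "(\<And>i. i \<in> A \<Longrightarrow> eq_upto m (f i) 1) \<Longrightarrow> eq_upto m (\<Prod>i\<in>A. f i) 1"
  using eq_upto_prod[of A m f "\<lambda>_. 1"] by simp

lemma eq_upto_add_X_power:
  fixes f :: "'a::comm_ring_1 fps"
  shows "m \<le> k \<Longrightarrow> eq_upto m (f + fps_X ^ k) f"
    and "m \<le> k \<Longrightarrow> eq_upto m (f - fps_X ^ k) f"
  by (auto simp: eq_upto_def)

text \<open>Factors of index at least m are 1 modulo \<open>fps_X ^ m\<close>, so both products
  agree with the one over the first m factors.\<close>

lemma prod_lessThan_eq_upto: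
  fixes g :: "nat \<Rightarrow> 'a::comm_ring_1 fps"
  assumes "\<And>i. eq_upto (Suc i) (g i) 1" "N \<ge> m" "M \<ge> m"
  shows "eq_upto m (\<Prod>i<N. g i) (\<Prod>i<M. g i)"
proof -
  have *: "eq_upto m (\<Prod>i<N. g i) (\<Prod>i<m. g i)" if "N \<ge> m" for N
  proof -
    have "(\<Prod>i<N. g i) = (\<Prod>i<m. g i) * (\<Prod>i\<in>{m..<N}. g i)"
      using prod.atLeastLessThan_concat[of 0 m N g] that by (simp add: atLeast0LessThan)
    moreover have "eq_upto m (\<Prod>i\<in>{m..<N}. g i) 1"
      by (intro eq_upto_prod_1 eq_upto_mono[OF assms(1)]) simp
    ultimately show ?thesis
      using eq_upto_mult[OF eq_upto_refl, where g' = 1] by (metis mult.right_neutral)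
  qed
  show ?thesis
    by (rule eq_upto_trans[OF *[OF assms(2)] eq_upto_sym[OF *[OF assms(3)]]])
qed

lemma fps_prodinf_eq_upto:
  fixes g :: "nat \<Rightarrow> 'a::idom fps"
  assumes g: "\<And>i. eq_upto (Suc i) (g i) 1" and N: "N \<ge> m"
  shows "eq_upto m (\<Prod>i. g i) (\<Prod>i<N. g i)"
proof -
  \<comment> \<open>The candidate limit is read off diagonally: coefficient n has stabilised once n
    + 1 factors are multiplied.\<close>
  define P where "P = Abs_fps (\<lambda>n. fps_nth (\<Prod>i<Suc n. g i) n)"
  have P_nth: "fps_nth P n = fps_nth (\<Prod>i<M. g i) n" if "M > n" for n M
    using prod_lessThan_eq_upto[OF g, where m = "Suc n" and N = "Suc n" and M = M] that
    by (simp add: P_def eq_upto_def)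
  \<comment> \<open>\<open>has_prod\<close> asks for a nonzero limit of the partial products; the
    constant coefficient provides it.\<close>
  have "fps_nth P 0 = 1"
    using g[of 0] by (simp add: P_def eq_upto_def)
  hence "P \<noteq> 0" by auto
  moreover have "(\<lambda>n. \<Prod>i\<le>n. g i) \<longlonglongrightarrow> P"
  proof (rule tendsto_fpsI)
    fix n show "eventually (\<lambda>k. fps_nth (\<Prod>i\<le>k. g i) n = fps_nth P n) sequentially"
      using eventually_ge_at_top[of n]
      by eventually_elim (simp only: lessThan_Suc_atMost [symmetric] P_nth [symmetric] le_imp_less_Suc)
  qed
  ultimately have "g has_prod P"
    by (simp add: has_prod_def raw_has_prod_def)
  hence "(\<Prod>i. g i) = P"
    by (rule has_prod_unique [symmetric])
  thus ?thesis
    using N by (simp add: eq_upto_def P_nth [symmetric])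
qed

lemma fps_prodinf_nth:
  fixes g :: "nat \<Rightarrow> 'a::idom fps"
  assumes "\<And>i. eq_upto (Suc i) (g i) 1" "N > n"
  shows "fps_nth (\<Prod>i. g i) n = fps_nth (\<Prod>i<N. g i) n"
  using fps_prodinf_eq_upto[OF assms(1), of "Suc n" N] assms(2) by (simp add: eq_upto_def)

lemma fps_prodinf_mult:
  fixes f g :: "nat \<Rightarrow> 'a::idom fps"
  assumes f: "\<And>i. eq_upto (Suc i) (f i) 1" and g: "\<And>i. eq_upto (Suc i) (g i) 1"
  shows "(\<Prod>i. f i * g i) = (\<Prod>i. f i) * (\<Prod>i. g i)"
proof (rule fps_ext)
  fix n
  have "eq_upto (Suc i) (f i * g i) 1" for i
    using eq_upto_mult[OF f g] by simp
  hence "fps_nth (\<Prod>i. f i * g i) n = fps_nth ((\<Prod>i<Suc n. f i) * (\<Prod>i<Suc n. g i)) n"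
    by (subst fps_prodinf_nth[where N = "Suc n"]) (simp_all only: prod.distrib lessI)
  also have "\<dots> = fps_nth ((\<Prod>i. f i) * (\<Prod>i. g i)) n"
    using eq_upto_mult[OF fps_prodinf_eq_upto[OF f, of "Suc n" "Suc n"] fps_prodinf_eq_upto[OF g, of "Suc n" "Suc n"]]
    by (simp add: eq_upto_def)
  finally show "fps_nth (\<Prod>i. f i * g i) n = fps_nth ((\<Prod>i. f i) * (\<Prod>i. g i)) n" .
qed

text \<open>Cuts a product into blocks of s consecutive factors, which separates the factors of an
  Euler product by residue class of the exponent.\<close>

lemma fps_prodinf_group:
  fixes g :: "nat \<Rightarrow> 'a::idom fps"
  assumes g: "\<And>i. eq_upto (Suc i) (g i) 1" and s: "s > 0"
  shows "(\<Prod>i. \<Prod>r<s. g (s * i + r)) = (\<Prod>i. g i)"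
proof (rule fps_ext)
  fix n
  have "i \<le> s * i + r" for i r
    using s by (simp add: trans_le_add1)
  hence "eq_upto (Suc i) (\<Prod>r<s. g (s * i + r)) 1" for i
    by (intro eq_upto_prod_1 eq_upto_mono[OF g]) simp
  hence "fps_nth (\<Prod>i. \<Prod>r<s. g (s * i + r)) n = fps_nth (\<Prod>i<Suc n. \<Prod>r<s. g (s * i + r)) n"
    by (rule fps_prodinf_nth) simp
  also have "(\<Prod>r<s. g (s * i + r)) = prod g {i * s..<i * s + s}" for i
    using prod.shift_bounds_nat_ivl[of g 0 "i * s" s] by (simp add: ac_simps lessThan_atLeast0)
  hence "(\<Prod>i<Suc n. \<Prod>r<s. g (s * i + r)) = (\<Prod>i<Suc n * s. g i)"
    by (simp only: prod.nat_group)
  also have "fps_nth \<dots> n = fps_nth (\<Prod>i. g i) n"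
  proof -
    have "Suc n * 1 \<le> Suc n * s"
      using s by (intro mult_le_mono) auto
    hence "n < Suc n * s" by (simp only: mult_1_right Suc_le_eq)
    thus ?thesis
      by (rule fps_prodinf_nth[OF g, symmetric])
  qed
  finally show "fps_nth (\<Prod>i. \<Prod>r<s. g (s * i + r)) n = fps_nth (\<Prod>i. g i) n" .
qed

section \<open>Generating functions and the Jacobi triple product\<close>

text \<open>Weights are integers so that quadratic forms in integer variables can be used directly.
  Negative weights would be dropped and infinite fibres would count as 0;
  \<open>finite_weight\<close> excludes both. Over \<open>bit\<close> a coefficient is the parity of
  a fibre.\<close>

definition gf :: "'b set \<Rightarrow> ('b \<Rightarrow> int) \<Rightarrow> 'a::comm_ring_1 fps" where
  "gf A w = Abs_fps (\<lambda>n. of_nat (card {x \<in> A. w x = int n}))"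

definition finite_weight :: "'b set \<Rightarrow> ('b \<Rightarrow> int) \<Rightarrow> bool" where
  "finite_weight A w \<longleftrightarrow> (\<forall>x\<in>A. 0 \<le> w x) \<and> (\<forall>n. finite {x \<in> A. w x = n})"

lemma finite_weightD:
  assumes "finite_weight A w"
  shows "x \<in> A \<Longrightarrow> 0 \<le> w x" "finite {x \<in> A. w x = n}"
  using assms by (auto simp: finite_weight_def)

lemma finite_weight_subset: "finite_weight A w \<Longrightarrow> B \<subseteq> A \<Longrightarrow> finite_weight B w"
  unfolding finite_weight_def by (auto intro: rev_finite_subset)

lemma finite_weight_reindex:
  assumes "finite_weight A w" "inj_on h B" "h ` B \<subseteq> A" "\<And>x. x \<in> B \<Longrightarrow> v x = w (h x)"
  shows "finite_weight B v"
  unfolding finite_weight_def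
proof (intro conjI allI ballI)
  show "0 \<le> v x" if "x \<in> B" for x
    using that assms by (auto simp: finite_weight_def)
  fix n
  have "h ` {x \<in> B. v x = n} \<subseteq> {x \<in> A. w x = n}"
    using assms by auto
  moreover have "inj_on h {x \<in> B. v x = n}"
    using assms(2) by (rule inj_on_subset) auto
  ultimately show "finite {x \<in> B. v x = n}"
    using inj_on_finite finite_weightD(2)[OF assms(1)] by blast
qed

lemma gf_nth: "fps_nth (gf A w) n = of_nat (card {x \<in> A. w x = int n})"
  by (simp add: gf_def)

lemma gf_cong: "A = B \<Longrightarrow> (\<And>x. x \<in> B \<Longrightarrow> w x = v x) \<Longrightarrow> gf A w = gf B v"
  unfolding gf_def by (intro arg_cong[where f = Abs_fps] ext arg_cong[where f = of_nat] arg_cong[where f = card]) auto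

lemma gf_reindex:
  assumes "bij_betw h B A" "\<And>x. x \<in> B \<Longrightarrow> w (h x) = v x"
  shows "gf A w = gf B v"
proof -
  have "card {x \<in> A. w x = int n} = card {x \<in> B. v x = int n}" for n
  proof (rule bij_betw_same_card[symmetric])
    show "bij_betw h {x \<in> B. v x = int n} {x \<in> A. w x = int n}"
      using assms by (intro bij_betw_subset[OF assms(1)]) (auto simp: bij_betw_def image_iff)
  qed
  thus ?thesis by (simp add: gf_def)
qed

lemma gf_Un:
  assumes "finite_weight A w" "finite_weight B w" "A \<inter> B = {}"
  shows "gf (A \<union> B) w = gf A w + gf B w"
proof (rule fps_ext)
  fix n
  have "{x \<in> A \<union> B. w x = int n} = {x \<in> A. w x = int n} \<union> {x \<in> B. w x = int n}"
    by auto
  moreover have "card \<dots> = card {x \<in> A. w x = int n} + card {x \<in> B. w x = int n}"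
    by (rule card_Un_disjoint) (use assms finite_weightD in auto)
  ultimately show "fps_nth (gf (A \<union> B) w) n = fps_nth (gf A w + gf B w) n"
    by (simp add: gf_nth)
qed

lemma gf_shift:
  assumes "finite_weight A w"
  shows "fps_X ^ c * gf A w = gf A (\<lambda>x. w x + int c)"
proof (rule fps_ext)
  fix n
  show "fps_nth (fps_X ^ c * gf A w) n = fps_nth (gf A (\<lambda>x. w x + int c)) n"
  proof (cases "n < c")
    case True
    hence "{x \<in> A. w x + int c = int n} = {}"
      using finite_weightD(1)[OF assms] by fastforce
    with True show ?thesis
      by (simp only: fps_X_power_mult_nth gf_nth) simp
  next
    case False
    hence "{x \<in> A. w x + int c = int n} = {x \<in> A. w x = int (n - c)}"
      by (auto simp: of_nat_diff)
    with False show ?thesis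
      by (simp add: fps_X_power_mult_nth gf_nth)
  qed
qed

lemma gf_mult:
  assumes "finite_weight A w" "finite_weight B v"
  shows "gf A w * gf B v = gf (A \<times> B) (\<lambda>(x, y). w x + v y)"
proof (rule fps_ext)
  fix n
  define S where "S i = {x \<in> A. w x = int i} \<times> {y \<in> B. v y = int (n - i)}" for i
  have "{z \<in> A \<times> B. (case z of (x, y) \<Rightarrow> w x + v y) = int n} = (\<Union>i\<in>{0..n}. S i)"
  proof (intro equalityI subsetI)
    fix z assume "z \<in> {z \<in> A \<times> B. (case z of (x, y) \<Rightarrow> w x + v y) = int n}"
    then obtain x y where z: "z = (x, y)" "x \<in> A" "y \<in> B" "w x + v y = int n" by auto
    hence "0 \<le> w x" "0 \<le> v y"
      using finite_weightD(1) assms by metis+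
    with z have "nat (w x) \<in> {0..n}" "z \<in> S (nat (w x))"
      by (auto simp: S_def of_nat_diff nat_le_iff)
    thus "z \<in> (\<Union>i\<in>{0..n}. S i)" by blast
  qed (auto simp: S_def of_nat_diff)
  moreover have "card (\<Union>i\<in>{0..n}. S i) = (\<Sum>i=0..n. card (S i))"
    using finite_weightD(2)[OF assms(1)] finite_weightD(2)[OF assms(2)]
    by (intro card_UN_disjoint) (auto simp: S_def simp del: of_nat_diff intro!: finite_cartesian_product)
  ultimately show "fps_nth (gf A w * gf B v) n = fps_nth (gf (A \<times> B) (\<lambda>(x, y). w x + v y)) n"
    by (simp add: gf_nth fps_mult_nth S_def card_cartesian_product)
qed

lemma finite_weight_times:
  assumes "finite_weight A w" "finite_weight B v"
  shows "finite_weight (A \<times> B) (\<lambda>(x, y). w x + v y)"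
  unfolding finite_weight_def
proof (intro conjI allI ballI)
  show "0 \<le> (case z of (x, y) \<Rightarrow> w x + v y)" if "z \<in> A \<times> B" for z
    using that finite_weightD(1)[OF assms(1)] finite_weightD(1)[OF assms(2)] by auto
  fix n
  have "{z \<in> A \<times> B. (case z of (x, y) \<Rightarrow> w x + v y) = n} \<subseteq>
      (\<Union>i\<in>{0..n}. {x \<in> A. w x = i} \<times> {y \<in> B. v y = n - i})"
  proof
    fix z assume "z \<in> {z \<in> A \<times> B. (case z of (x, y) \<Rightarrow> w x + v y) = n}"
    then obtain x y where z: "z = (x, y)" "x \<in> A" "y \<in> B" "w x + v y = n" by auto
    hence "0 \<le> w x" "0 \<le> v y"
      using finite_weightD(1) assms by metis+
    with z show "z \<in> (\<Union>i\<in>{0..n}. {x \<in> A. w x = i} \<times> {y \<in> B. v y = n - i})"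
      by auto
  qed
  moreover have "finite (\<Union>i\<in>{0..n}. {x \<in> A. w x = i} \<times> {y \<in> B. v y = n - i})"
    using finite_weightD(2)[OF assms(1)] finite_weightD(2)[OF assms(2)]
    by (intro finite_UN_I finite_cartesian_product) auto
  ultimately show "finite {z \<in> A \<times> B. (case z of (x, y) \<Rightarrow> w x + v y) = n}"
    by (rule finite_subset)
qed

section \<open>Gaussian binomial coefficients and the q-binomial theorem\<close>

fun qbin :: "'a::comm_ring_1 \<Rightarrow> nat \<Rightarrow> nat \<Rightarrow> 'a" where
  "qbin q n 0 = 1"
| "qbin q 0 (Suc k) = 0"
| "qbin q (Suc n) (Suc k) = qbin q n k + q ^ Suc k * qbin q n (Suc k)"

definition qfact :: "'a::comm_ring_1 \<Rightarrow> nat \<Rightarrow> 'a" where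
  "qfact q n = (\<Prod>i<n. 1 - q ^ Suc i)"

lemma qbin_eq_0: "n < k \<Longrightarrow> qbin q n k = 0"
  by (induction q n k rule: qbin.induct) auto

lemma qfact_Suc: "qfact q (Suc n) = qfact q n * (1 - q ^ Suc n)"
  by (simp add: qfact_def)

text \<open>The quotient formula for Gaussian binomials with denominators cleared. With n = k + d +
  1, the induction step rests on (1 - q^(k+1)) + q^(k+1) (1 - q^(d+1)) = 1 - q^(n+1).\<close>

lemma qbin_mult_qfact: "k \<le> n \<Longrightarrow> qbin q n k * qfact q k * qfact q (n - k) = qfact q n"
proof (induction q n k rule: qbin.induct)
  case (1 q n)
  thus ?case by (simp add: qfact_def)
next
  case (3 q n k)
  hence IH: "qbin q n k * qfact q k * qfact q (n - k) = qfact q n" by simp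
  show ?case
  proof (cases "k = n")
    case True
    have "qfact q 0 = 1" by (simp add: qfact_def)
    thus ?thesis using IH True by (simp add: qbin_eq_0 qfact_Suc mult.assoc [symmetric])
  next
    case False
    with 3 have "k < n" by simp
    then obtain d where n: "n = Suc (k + d)" by (metis less_iff_Suc_add)
    have IH2: "qbin q n (Suc k) * qfact q (Suc k) * qfact q d = qfact q n"
      using 3 n by simp
    have IH1: "qbin q n k * qfact q k * (qfact q d * (1 - q ^ Suc d)) = qfact q n"
      using IH n by (simp add: qfact_Suc Suc_diff_le)
    have "qbin q (Suc n) (Suc k) * qfact q (Suc k) * qfact q (Suc n - Suc k) =
        (qbin q n k * qfact q k * (qfact q d * (1 - q ^ Suc d))) * (1 - q ^ Suc k) +
        q ^ Suc k * (1 - q ^ Suc d) * (qbin q n (Suc k) * qfact q (Suc k) * qfact q d)"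
      by (simp add: n qfact_Suc Suc_diff_le del: power_Suc) (simp add: algebra_simps)
    also have "\<dots> = qfact q n * (1 - q ^ Suc k * q ^ Suc d)"
      unfolding IH1 IH2 by (simp add: algebra_simps)
    also have "q ^ Suc k * q ^ Suc d = q ^ Suc n"
      by (simp add: n power_add)
    finally show ?thesis by (simp add: qfact_Suc)
  qed
qed auto

text \<open>The form homogeneous in x and z is needed later: x will be a high power of
  \<open>fps_X\<close>, which replaces the negative powers of the usual proof of the triple product.
  The induction splits off the factor i = 0, leaving the same product with z q for z, and then uses
  the q-Pascal rule.\<close>

lemma q_binomial_theorem:
  fixes q x z :: "'a::comm_ring_1"
  shows "(\<Prod>i<n. x + z * q ^ i) = (\<Sum>j\<le>n. q ^ (j choose 2) * qbin q n j * z ^ j * x ^ (n - j))"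
proof (induction n arbitrary: z)
  case (Suc n)
  define c where "c j = q ^ (j choose 2) * q ^ j * qbin q n j * z ^ j" for j
  have c0: "c (Suc n) = 0" by (simp add: c_def qbin_eq_0)
  have "(\<Prod>i<Suc n. x + z * q ^ i) = (x + z) * (\<Prod>i<n. x + (z * q) * q ^ i)"
    by (subst prod.lessThan_Suc_shift) (simp add: mult.assoc)
  also have "\<dots> = (x + z) * (\<Sum>j\<le>n. c j * x ^ (n - j))"
    unfolding Suc.IH by (simp add: c_def power_mult_distrib ac_simps)
  also have "\<dots> = (\<Sum>j\<le>n. c j * x ^ (Suc n - j)) + (\<Sum>j\<le>n. z * c j * x ^ (n - j))"
    by (simp add: distrib_right sum_distrib_left Suc_diff_le mult.assoc mult.left_commute sum.distrib distrib_left)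
  also have "(\<Sum>j\<le>n. c j * x ^ (Suc n - j)) = (\<Sum>j\<le>Suc n. c j * x ^ (Suc n - j))"
    using c0 by simp
  also have "\<dots> = c 0 * x ^ Suc n + (\<Sum>j\<le>n. c (Suc j) * x ^ (n - j))"
    by (subst sum.atMost_Suc_shift) simp
  also have "\<dots> + (\<Sum>j\<le>n. z * c j * x ^ (n - j)) =
      x ^ Suc n + (\<Sum>j\<le>n. (c (Suc j) + z * c j) * x ^ (n - j))"
    by (simp add: sum.distrib distrib_right c_def binomial_eq_0)
  also have "(\<Sum>j\<le>n. (c (Suc j) + z * c j) * x ^ (n - j)) =
      (\<Sum>j\<le>n. q ^ (Suc j choose 2) * qbin q (Suc n) (Suc j) * z ^ Suc j * x ^ (Suc n - Suc j))"
  proof (rule sum.cong)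
    fix j
    have "Suc j choose 2 = (j choose 2) + j"
      by (simp add: numeral_2_eq_2)
    thus "(c (Suc j) + z * c j) * x ^ (n - j) =
        q ^ (Suc j choose 2) * qbin q (Suc n) (Suc j) * z ^ Suc j * x ^ (Suc n - Suc j)"
      by (simp add: c_def power_add algebra_simps)
  qed simp
  finally show ?case
    by (subst sum.atMost_Suc_shift) (simp add: binomial_eq_0)
qed (simp add: binomial_eq_0)

section \<open>Theta series and the Jacobi triple product\<close>

definition tw :: "nat \<Rightarrow> nat \<Rightarrow> int \<Rightarrow> int" where
  "tw a b k = (int a * (k * (k + 1)) + int b * (k * (k - 1))) div 2"

text \<open>Ramanujan's two-variable theta function f(q^a, q^b), summed over all integers k.\<close>

definition theta :: "nat \<Rightarrow> nat \<Rightarrow> 'a::comm_ring_1 fps" where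
  "theta a b = gf UNIV (tw a b)"

lemma two_tw: "2 * tw a b k = int a * (k * (k + 1)) + int b * (k * (k - 1))"
proof -
  have "even (int a * (k * (k + 1)) + int b * (k * (k - 1)))" by auto
  thus ?thesis unfolding tw_def by simp
qed

lemma tw_eqI: "2 * n = int a * (k * (k + 1)) + int b * (k * (k - 1)) \<Longrightarrow> tw a b k = n"
  using two_tw[of a b k] by simp

text \<open>Twice the weight is at least k(k+1) + k(k-1) = 2 k^2. The bound makes fibres finite and
  confines the indices of weight n to -n..n.\<close>

lemma tw_ge:
  assumes "a > 0" "b > 0"
  shows "\<bar>k\<bar> \<le> tw a b k"
proof -
  have 1: "0 \<le> k * (k + 1)" "0 \<le> k * (k - 1)"
    by (cases "k \<ge> 0"; simp add: zero_le_mult_iff; linarith)+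
  have "1 * (k * (k + 1)) \<le> int a * (k * (k + 1))" "1 * (k * (k - 1)) \<le> int b * (k * (k - 1))"
    using assms 1 by (intro mult_right_mono; simp)+
  hence "2 * (k * k) \<le> 2 * tw a b k"
    unfolding two_tw by (simp add: algebra_simps)
  moreover have "\<bar>k\<bar> \<le> k * k"
    using 1 by (simp add: algebra_simps abs_if)
  ultimately show ?thesis by linarith
qed

lemma finite_weight_UNIV_int:
  fixes w :: "int \<Rightarrow> int"
  assumes "\<And>k. \<bar>k\<bar> \<le> w k"
  shows "finite_weight UNIV w"
  unfolding finite_weight_def
proof (intro conjI allI ballI)
  show "0 \<le> w k" for k
    using assms[of k] by linarith
  fix n
  have "k \<in> {-n..n}" if "w k = n" for k
    using assms[of k] that by auto
  hence "{k \<in> UNIV. w k = n} \<subseteq> {-n..n}"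
    by blast
  thus "finite {k \<in> UNIV. w k = n}"
    by (rule finite_subset) simp
qed

lemma finite_weight_tw: "a > 0 \<Longrightarrow> b > 0 \<Longrightarrow> finite_weight UNIV (tw a b)"
  by (intro finite_weight_UNIV_int tw_ge)

text \<open>The q-binomial theorem with 2N factors, base \<open>Q\<close>, z = q^a and x =
  q^((a+b)N). The central index N becomes 0 after the shift j - N.\<close>

lemma finite_jacobi_triple_product:
  fixes a b N :: nat
  defines "Q \<equiv> (fps_X :: 'a::idom fps) ^ (a + b)"
  assumes ab: "a > 0" "b > 0"
  shows "(\<Prod>i<N. (1 + fps_X ^ (a + (a + b) * i)) * (1 + fps_X ^ (b + (a + b) * i))) =
    (\<Sum>j\<le>2*N. qbin Q (2*N) j * fps_X ^ nat (tw a b (int j - int N)))"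
proof -
  define A where "A = a + b"
  \<comment> \<open>The exponent of the monomial that both sides carry and that is cancelled at the
    end.\<close>
  define E where "E = (\<Sum>i<N. a + A * i) + A * N * N"
  let ?X = "fps_X :: 'a fps"
  have twoE: "2 * int E = 2 * a * N + int A * N * (int N - 1) + 2 * A * N * N"
  proof -
    have "2 * int (\<Sum>i<N. a + A * i) = 2 * a * N + int A * N * (int N - 1)"
      by (induction N) (auto simp: algebra_simps)
    thus ?thesis by (simp add: E_def)
  qed
  \<comment> \<open>From each factor the smaller power is pulled out: q^(a + A i) when i < N, and
    q^(A N) when i is at least N. The first half then yields the b-progression in reverse order, the
    second half the a-progression.\<close>
  have "(\<Prod>i<2*N. ?X ^ (A * N) + ?X ^ a * Q ^ i) =
      (\<Prod>i<N. ?X ^ (A * N) + ?X ^ a * Q ^ i) * (\<Prod>i=N..<2*N. ?X ^ (A * N) + ?X ^ a * Q ^ i)"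
    using prod.atLeastLessThan_concat[of 0 N "2*N" "\<lambda>i. ?X ^ (A * N) + ?X ^ a * Q ^ i"]
    by (simp add: atLeast0LessThan)
  also have "(\<Prod>i<N. ?X ^ (A * N) + ?X ^ a * Q ^ i) =
      (\<Prod>i<N. ?X ^ (a + A * i) * (1 + ?X ^ (b + A * (N - Suc i))))"
  proof (rule prod.cong)
    fix i assume "i \<in> {..<N}"
    then obtain d where N: "N = Suc (i + d)" by (metis less_iff_Suc_add lessThan_iff)
    have "a + A * i + (b + A * (N - Suc i)) = A * N"
      by (simp add: N A_def algebra_simps)
    hence "?X ^ (A * N) = ?X ^ (a + A * i) * ?X ^ (b + A * (N - Suc i))"
      by (metis power_add)
    thus "?X ^ (A * N) + ?X ^ a * Q ^ i = ?X ^ (a + A * i) * (1 + ?X ^ (b + A * (N - Suc i)))"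
      by (simp add: Q_def A_def power_add power_mult distrib_left)
  qed simp
  also have "\<dots> = ?X ^ (\<Sum>i<N. a + A * i) * (\<Prod>i<N. 1 + ?X ^ (b + A * i))"
    using prod.nat_diff_reindex[of "\<lambda>i. 1 + ?X ^ (b + A * i)" N]
    by (simp add: prod.distrib power_sum)
  also have "(\<Prod>i=N..<2*N. ?X ^ (A * N) + ?X ^ a * Q ^ i) =
      (\<Prod>i<N. ?X ^ (A * N) + ?X ^ a * Q ^ (i + N))"
    using prod.shift_bounds_nat_ivl[of "\<lambda>i. ?X ^ (A * N) + ?X ^ a * Q ^ i" 0 N N]
    by (simp add: atLeast0LessThan mult_2)
  also have "\<dots> = (\<Prod>i<N. ?X ^ (A * N) * (1 + ?X ^ (a + A * i)))"
    by (intro prod.cong) (simp_all add: Q_def A_def power_mult [symmetric] power_add [symmetric] algebra_simps)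
  also have "\<dots> = ?X ^ (A * N * N) * (\<Prod>i<N. 1 + ?X ^ (a + A * i))"
    by (simp add: prod.distrib power_mult)
  finally have lhs: "(\<Prod>i<2*N. ?X ^ (A * N) + ?X ^ a * Q ^ i) =
      ?X ^ E * (\<Prod>i<N. (1 + ?X ^ (a + A * i)) * (1 + ?X ^ (b + A * i)))"
    by (simp add: E_def power_add prod.distrib ac_simps)
  have summand: "Q ^ (j choose 2) * qbin Q (2*N) j * (?X ^ a) ^ j * (?X ^ (A * N)) ^ (2*N - j) =
      ?X ^ E * (qbin Q (2*N) j * ?X ^ nat (tw a b (int j - int N)))" if "j \<le> 2 * N" for j
  proof -
    \<comment> \<open>The exponents are compared as integers after doubling, which removes the
      halves in the binomial coefficient and in \<open>tw\<close>.\<close>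
    have "Suc k choose 2 = (k choose 2) + k" for k
      by (simp add: numeral_2_eq_2)
    hence "2 * int (j choose 2) = int j * (int j - 1)"
      by (induction j) (simp_all add: binomial_eq_0 algebra_simps)
    hence "2 * (int A * int (j choose 2)) = int A * (int j * (int j - 1))"
      by simp
    moreover have "int (2*N - j) = 2 * int N - int j"
      using that by (simp add: of_nat_diff)
    hence "2 * int (A * (j choose 2) + a * j + A * N * (2*N - j)) =
        2 * (int A * int (j choose 2)) + 2 * (int a * int j) + 2 * int A * int N * (2 * int N - int j)"
      by (simp only: of_nat_add of_nat_mult distrib_left mult.assoc)
    ultimately have "2 * int (A * (j choose 2) + a * j + A * N * (2*N - j)) =
        2 * int E + 2 * tw a b (int j - int N)"
      unfolding twoE two_tw by (simp add: A_def algebra_simps)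
    hence "int (A * (j choose 2) + a * j + A * N * (2*N - j)) = int E + tw a b (int j - int N)"
      unfolding distrib_left [symmetric] by (rule mult_left_cancel[THEN iffD1, rotated]) simp
    moreover have "0 \<le> tw a b (int j - int N)"
      using tw_ge[OF ab, of "int j - int N"] by linarith
    ultimately have "int (A * (j choose 2) + a * j + A * N * (2*N - j)) = int (E + nat (tw a b (int j - int N)))"
      by (simp only: of_nat_add [of E] int_nat_eq if_True)
    hence "A * (j choose 2) + a * j + A * N * (2*N - j) = E + nat (tw a b (int j - int N))"
      by (rule of_nat_eq_iff[THEN iffD1])
    hence "?X ^ (A * (j choose 2)) * ?X ^ (a * j) * ?X ^ (A * N * (2*N - j)) =
        ?X ^ E * ?X ^ nat (tw a b (int j - int N))"
      unfolding power_add [symmetric] by (rule arg_cong)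
    hence "qbin Q (2*N) j * (?X ^ (A * (j choose 2)) * ?X ^ (a * j) * ?X ^ (A * N * (2*N - j))) =
        qbin Q (2*N) j * (?X ^ E * ?X ^ nat (tw a b (int j - int N)))"
      by (rule arg_cong)
    thus ?thesis
      unfolding Q_def A_def [symmetric] power_mult [symmetric] by (simp only: ac_simps)
  qed
  have "?X ^ E * (\<Prod>i<N. (1 + ?X ^ (a + A * i)) * (1 + ?X ^ (b + A * i))) =
      (\<Sum>j\<le>2*N. ?X ^ E * (qbin Q (2*N) j * ?X ^ nat (tw a b (int j - int N))))"
    unfolding lhs [symmetric] q_binomial_theorem by (intro sum.cong summand) auto
  also have "\<dots> = ?X ^ E * (\<Sum>j\<le>2*N. qbin Q (2*N) j * ?X ^ nat (tw a b (int j - int N)))"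
    by (simp add: sum_distrib_left)
  finally show ?thesis
    by (simp add: A_def)
qed

lemma qfact_eq_upto:
  assumes "m \<le> N" "m \<le> M" "c > 0"
  shows "eq_upto m (qfact ((fps_X :: 'a::comm_ring_1 fps) ^ c) N) (qfact (fps_X ^ c) M)"
proof -
  have "Suc i \<le> c * Suc i" for i
    using assms(3) by (cases c) auto
  hence "eq_upto (Suc i) (1 - (fps_X ^ c) ^ Suc i :: 'a fps) 1" for i
    unfolding power_mult [symmetric] by (rule eq_upto_add_X_power)
  thus ?thesis
    unfolding qfact_def using assms by (intro prod_lessThan_eq_upto)
qed

lemma qfact_nonzero:
  assumes "c > 0"
  shows "qfact ((fps_X :: 'a::idom fps) ^ c) n \<noteq> 0"
proof -
  have "fps_nth (qfact ((fps_X :: 'a fps) ^ c) n) 0 = 1"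
    using assms by (induction n) (simp_all add: qfact_def)
  thus ?thesis by auto
qed

text \<open>\<open>qfact Q j * qbin Q n j\<close> is the product of 1 - Q^i over n - j < i <= n,
  hence 1 modulo \<open>fps_X ^ m\<close> when n - j is at least m; and \<open>qfact Q N\<close>
  agrees with \<open>qfact Q j\<close> to that order. So central Gaussian binomials tend to the
  inverse of the infinite product.\<close>

lemma qfact_mult_qbin_eq_upto:
  fixes Q :: "'a::idom fps"
  assumes Q: "Q = fps_X ^ c" and c: "c > 0" and j: "m \<le> j" "j + m \<le> n" and N: "m \<le> N"
  shows "eq_upto m (qfact Q N * qbin Q n j) 1"
proof -
  define R where "R = (\<Prod>i=n-j..<n. 1 - Q ^ Suc i)"
  have "qfact Q n = qfact Q (n - j) * R"
    unfolding qfact_def R_def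
    using prod.atLeastLessThan_concat[of 0 "n - j" n "\<lambda>i. 1 - Q ^ Suc i"] by (simp add: atLeast0LessThan)
  hence "qfact Q j * qbin Q n j = R"
    using qbin_mult_qfact[of j n Q] j qfact_nonzero[OF c, of "n - j", where ?'a = 'a]
    by (simp add: Q ac_simps)
  moreover have "eq_upto m R 1"
  proof -
    have "eq_upto m (1 - Q ^ Suc i) 1" if "i \<ge> n - j" for i
    proof -
      have "m \<le> Suc i" using that j by linarith
      also have "Suc i \<le> c * Suc i" using c by (cases c) auto
      finally show ?thesis
        unfolding Q power_mult [symmetric] by (rule eq_upto_add_X_power)
    qed
    thus ?thesis unfolding R_def by (intro eq_upto_prod_1) auto
  qed
  moreover have "eq_upto m (qfact Q N * qbin Q n j) (qfact Q j * qbin Q n j)"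
    unfolding Q using qfact_eq_upto[OF N j(1) c] by (intro eq_upto_mult) auto
  ultimately show ?thesis using eq_upto_trans by metis
qed

lemma jacobi_triple_product:
  assumes ab: "a > 0" "b > 0"
  shows "(\<Prod>i. (1 + fps_X ^ (a + (a + b) * i)) * (1 + fps_X ^ (b + (a + b) * i)) *
           (1 - fps_X ^ ((a + b) * Suc i))) = (theta a b :: 'a::idom fps)"
proof (rule fps_ext)
  fix n
  define g where "g i = (1 + fps_X ^ (a + (a + b) * i)) * (1 + fps_X ^ (b + (a + b) * i)) *
           (1 - fps_X ^ ((a + b) * Suc i) :: 'a fps)" for i
  define Q where "Q = (fps_X :: 'a fps) ^ (a + b)"
  \<comment> \<open>Large enough that an index j with |j - N| <= n satisfies both j >= n + 1 and j +
    n + 1 <= 2N, as the estimate for Gaussian binomials requires.\<close>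
  define N where "N = 2 * Suc n"
  let ?t = "\<lambda>j. tw a b (int j - int N)"
  have g: "eq_upto (Suc i) (g i) 1" for i
  proof -
    have "1 \<le> a + b" using ab by linarith
    hence "1 * Suc i \<le> (a + b) * Suc i" "1 * i \<le> (a + b) * i"
      by (rule mult_le_mono1)+
    hence "Suc i \<le> (a + b) * Suc i" "i \<le> (a + b) * i"
      by (simp_all only: mult_1_left)
    hence le: "Suc i \<le> a + (a + b) * i" "Suc i \<le> b + (a + b) * i" "Suc i \<le> (a + b) * Suc i"
      using ab by (assumption | linarith)+
    have "eq_upto (Suc i) (g i) (1 * 1 * 1)"
      unfolding g_def using le by (intro eq_upto_mult eq_upto_add_X_power)
    thus ?thesis by simp
  qed
  have "(\<Prod>i<N. g i) = (\<Prod>i<N. (1 + fps_X ^ (a + (a + b) * i)) * (1 + fps_X ^ (b + (a + b) * i))) * qfact Q N"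
    unfolding Q_def qfact_def power_mult [symmetric] prod.distrib [symmetric] g_def ..
  also have "\<dots> = (\<Sum>j\<le>2*N. qfact Q N * qbin Q (2*N) j * fps_X ^ nat (?t j))"
    unfolding finite_jacobi_triple_product[OF ab] Q_def [symmetric]
    by (simp add: sum_distrib_left ac_simps)
  finally have "fps_nth (\<Prod>i. g i) n = (\<Sum>j\<le>2*N. fps_nth (qfact Q N * qbin Q (2*N) j * fps_X ^ nat (?t j)) n)"
    using fps_prodinf_nth[OF g, where N = N and n = n] by (simp add: N_def fps_sum_nth)
  also have "\<dots> = (\<Sum>j\<le>2*N. if ?t j = int n then 1 else 0)"
  proof (rule sum.cong)
    fix j assume j: "j \<in> {..2*N}"
    have t: "\<bar>int j - int N\<bar> \<le> ?t j" by (rule tw_ge[OF ab])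
    show "fps_nth (qfact Q N * qbin Q (2*N) j * fps_X ^ nat (?t j)) n = (if ?t j = int n then 1 else 0)"
    proof (cases "?t j \<le> int n")
      case True
      hence "\<bar>int j - int N\<bar> \<le> int n" using t by linarith
      hence "eq_upto (Suc n) (qfact Q N * qbin Q (2*N) j) 1"
        using ab by (intro qfact_mult_qbin_eq_upto[OF Q_def]) (auto simp: N_def)
      with True t show ?thesis
        by (auto simp: fps_X_power_mult_right_nth eq_upto_def nat_le_iff)
    next
      case False
      thus ?thesis by (auto simp: fps_X_power_mult_right_nth nat_le_iff)
    qed
  qed simp
  also have "\<dots> = of_nat (card {j \<in> {..2*N}. ?t j = int n})"
    by (simp add: sum.If_cases Int_def)
  also have "card {j \<in> {..2*N}. ?t j = int n} = card {k \<in> UNIV. tw a b k = int n}"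
  proof (rule bij_betw_same_card)
    show "bij_betw (\<lambda>j. int j - int N) {j \<in> {..2*N}. ?t j = int n} {k \<in> UNIV. tw a b k = int n}"
      unfolding bij_betw_def
    proof (intro conjI equalityI subsetI)
      fix k assume k: "k \<in> {k \<in> UNIV. tw a b k = int n}"
      hence "\<bar>k\<bar> \<le> int n" using tw_ge[OF ab, of k] by simp
      with k show "k \<in> (\<lambda>j. int j - int N) ` {j \<in> {..2*N}. ?t j = int n}"
        by (intro image_eqI[of _ _ "nat (k + int N)"]) (auto simp: N_def)
    qed (auto simp: inj_on_def)
  qed
  finally show "fps_nth (\<Prod>i. (1 + fps_X ^ (a + (a + b) * i)) * (1 + fps_X ^ (b + (a + b) * i)) *
           (1 - fps_X ^ ((a + b) * Suc i))) n = fps_nth (theta a b :: 'a fps) n"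
    by (simp add: g_def theta_def gf_nth)
qed

section \<open>Euler products and theta series modulo 2\<close>

declare add_bit_eq_xor [simp del] mult_bit_eq_and [simp del]

lemma bit_fps_add_self [simp]: "f + f = (0 :: bit fps)"
proof (rule fps_ext)
  fix n
  have "fps_nth f n + fps_nth f n = 2 * fps_nth f n" by (simp only: mult_2)
  thus "fps_nth (f + f) n = fps_nth 0 n" by (simp only: fps_add_nth bit_2_eq_0 mult_zero_left fps_zero_nth)
qed

lemma bit_fps_uminus [simp]: "- f = (f :: bit fps)"
  by (rule fps_ext) simp

lemma bit_fps_diff [simp]: "f - g = f + (g :: bit fps)"
  by (rule fps_ext) simp

lemma bit_fps_add_eq_0_iff: "f + g = 0 \<longleftrightarrow> f = (g :: bit fps)"
  using eq_neg_iff_add_eq_0[of f g] by simp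

text \<open>Points moved by h pair up inside each fibre, so they contribute an even number.\<close>

lemma gf_involution:
  assumes fin: "finite_weight A w"
    and h: "\<And>x. x \<in> A \<Longrightarrow> h x \<in> A" "\<And>x. x \<in> A \<Longrightarrow> h (h x) = x" "\<And>x. x \<in> A \<Longrightarrow> w (h x) = w x"
  shows "(gf A w :: bit fps) = gf {x \<in> A. h x = x} w"
proof (rule fps_ext)
  fix n
  let ?S = "{x \<in> A. w x = int n}"
  let ?N = "{x \<in> ?S. h x \<noteq> x}"
  have "(\<Sum>x\<in>?N. 1 :: bit) = 0"
    by (rule sum_involution_eq_0[where h = h]) (auto simp: h)
  hence zero: "(of_nat (card ?N) :: bit) = 0" by simp
  have "card ?S = card ({x \<in> {x \<in> A. h x = x}. w x = int n} \<union> ?N)"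
    by (rule arg_cong[where f = card]) auto
  also have "\<dots> = card {x \<in> {x \<in> A. h x = x}. w x = int n} + card ?N"
    by (rule card_Un_disjoint) (auto intro: finite_subset[OF _ finite_weightD(2)[OF fin, of "int n"]])
  finally show "fps_nth (gf A w :: bit fps) n = fps_nth (gf {x \<in> A. h x = x} w) n"
    using zero by (simp only: gf_nth of_nat_add add_0_right)
qed

lemma gf_compose_X_power:
  assumes "c > 0"
  shows "gf A w oo fps_X ^ c = gf A (\<lambda>x. int c * w x)"
proof (rule fps_ext)
  fix n
  have "{x \<in> A. int c * w x = int n} = (if c dvd n then {x \<in> A. w x = int (n div c)} else {})"
  proof (cases "c dvd n")
    case True
    then obtain m where "n = c * m" by auto
    thus ?thesis using assms by auto
  next
    case False
    hence "\<not> int c dvd int n" by simp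
    hence "int c * y \<noteq> int n" for y by (metis dvd_triv_left)
    with False show ?thesis by auto
  qed
  thus "fps_nth (gf A w oo fps_X ^ c) n = fps_nth (gf A (\<lambda>x. int c * w x)) n"
    by (simp add: fps_nth_compose_X_power gf_nth)
qed

lemma tw_scale: "tw (c * a) (c * b) k = int c * tw a b k"
  by (rule tw_eqI) (simp only: mult.left_commute[of 2] two_tw of_nat_mult distrib_left mult.assoc)

lemma theta_compose_X_power:
  assumes "c > 0"
  shows "theta a b oo fps_X ^ c = theta (c * a) (c * b)"
  unfolding theta_def gf_compose_X_power[OF assms] by (intro gf_cong) (simp_all add: tw_scale)

section \<open>Euler products as theta series modulo 2\<close>

definition euler_prod :: "nat \<Rightarrow> bit fps" (\<open>\<f>\<close>) where
  "\<f> k = (\<Prod>i. 1 + fps_X ^ (k * Suc i))"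

lemma mult_Suc_ge: "k > 0 \<Longrightarrow> Suc i \<le> k * Suc i" for k :: nat
  by (cases k) auto

lemma euler_factor_eq_upto: "k > 0 \<Longrightarrow> eq_upto (Suc i) (1 + fps_X ^ (k * Suc i) :: bit fps) 1"
  by (intro eq_upto_add_X_power mult_Suc_ge)

lemma euler_prod_nonzero:
  assumes "k > 0"
  shows "\<f> k \<noteq> 0"
proof -
  have "fps_nth (\<f> k) 0 = fps_nth (\<Prod>i<1. 1 + fps_X ^ (k * Suc i) :: bit fps) 0"
    unfolding euler_prod_def by (rule fps_prodinf_nth[OF euler_factor_eq_upto[OF assms]]) simp
  also have "\<dots> = 1"
    using assms by simp
  finally show ?thesis by auto
qed

lemma euler_prod_square:
  assumes "k > 0"
  shows "\<f> k * \<f> k = \<f> (2 * k)"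
proof -
  have "(1 + x) * (1 + x) = 1 + x * x" for x :: "bit fps"
    by (simp add: distrib_left distrib_right add.assoc [symmetric])
  hence "(1 + fps_X ^ (k * Suc i)) * (1 + fps_X ^ (k * Suc i)) = (1 + fps_X ^ (2 * k * Suc i) :: bit fps)" for i
    by (simp only: power_add [symmetric] mult_2 distrib_right)
  moreover have "\<f> k * \<f> k = (\<Prod>i. (1 + fps_X ^ (k * Suc i)) * (1 + fps_X ^ (k * Suc i)))"
    unfolding euler_prod_def using euler_factor_eq_upto[OF assms] by (intro fps_prodinf_mult [symmetric])
  ultimately show ?thesis
    by (simp only: euler_prod_def)
qed

lemma euler_prod_group:
  assumes "k > 0" "s > 0"
  shows "\<f> k = (\<Prod>i. \<Prod>r<s. 1 + fps_X ^ (k * Suc (s * i + r)))"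
  unfolding euler_prod_def
  using fps_prodinf_group[where g = "\<lambda>i. 1 + fps_X ^ (k * Suc i) :: bit fps", OF euler_factor_eq_upto] assms
  by simp

lemma theta_prod:
  assumes "a > 0" "b > 0"
  shows "theta a b = (\<Prod>i. (1 + fps_X ^ (a + (a + b) * i)) * (1 + fps_X ^ (b + (a + b) * i)) *
           (1 + fps_X ^ ((a + b) * Suc i)) :: bit fps)"
  using jacobi_triple_product[OF assms, where ?'a = bit] by simp

lemma theta_prod_eq_upto:
  assumes "a > 0" "b > 0"
  shows "eq_upto (Suc i) ((1 + fps_X ^ (a + (a + b) * i)) * (1 + fps_X ^ (b + (a + b) * i)) *
           (1 + fps_X ^ ((a + b) * Suc i)) :: bit fps) 1"
proof -
  have "Suc i \<le> (a + b) * Suc i"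
    using assms by (intro mult_Suc_ge) simp
  moreover have "i \<le> (a + b) * i"
    using assms by (cases i) (use mult_Suc_ge[of "a + b"] in auto)
  ultimately have "Suc i \<le> a + (a + b) * i" "Suc i \<le> b + (a + b) * i" "Suc i \<le> (a + b) * Suc i"
    using assms by (assumption | linarith)+
  hence "eq_upto (Suc i) ((1 + fps_X ^ (a + (a + b) * i)) * (1 + fps_X ^ (b + (a + b) * i)) *
           (1 + fps_X ^ ((a + b) * Suc i)) :: bit fps) (1 * 1 * 1)"
    by (intro eq_upto_mult eq_upto_add_X_power)
  thus ?thesis by simp
qed

lemma prod_lessThan_numeral:
  fixes g :: "nat \<Rightarrow> 'a::comm_monoid_mult"
  shows "(\<Prod>r<2. g r) = g 0 * g 1" "(\<Prod>r<3. g r) = g 0 * g 1 * g 2"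
    "(\<Prod>r<4. g r) = g 0 * g 1 * g 2 * g 3" "(\<Prod>r<5. g r) = g 0 * g 1 * g 2 * g 3 * g 4"
  by (simp_all add: eval_nat_numeral)

text \<open>The pentagonal number theorem modulo 2: the three progressions k, 2k and 3k modulo 3k of
  the triple product run through every positive multiple of k once.\<close>

lemma euler_prod_eq_theta:
  assumes "k > 0"
  shows "\<f> k = theta k (2 * k)"
proof -
  have k2: "2 * k > 0" using assms by simp
  have "\<f> k = (\<Prod>i. \<Prod>r<3. 1 + fps_X ^ (k * Suc (3 * i + r)))"
    using assms by (intro euler_prod_group) auto
  also have "\<dots> = theta k (2 * k)"
    unfolding theta_prod[OF assms k2]
  proof (intro arg_cong[where f = prodinf] ext)
    fix i
    have "k * Suc (3 * i + 0) = k + (k + 2 * k) * i" "k * Suc (3 * i + 1) = 2 * k + (k + 2 * k) * i"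
      "k * Suc (3 * i + 2) = (k + 2 * k) * Suc i"
      by (simp_all add: algebra_simps)
    thus "(\<Prod>r<3. 1 + fps_X ^ (k * Suc (3 * i + r))) =
        (1 + fps_X ^ (k + (k + 2 * k) * i)) * (1 + fps_X ^ (2 * k + (k + 2 * k) * i)) *
        (1 + fps_X ^ ((k + 2 * k) * Suc i) :: bit fps)"
      by (simp only: prod_lessThan_numeral)
  qed
  finally show ?thesis .
qed

text \<open>Jacobi's identity for the cube modulo 2; for k = 1 the exponents 2m^2 - m, m an integer,
  are the triangular numbers.\<close>

lemma euler_prod_cube_eq_theta:
  assumes "k > 0"
  shows "\<f> k ^ 3 = theta k (3 * k)"
proof -
  have k: "3 * k > 0" "2 * k > 0" "4 * k > 0" using assms by auto
  have fk: "\<f> k = (\<Prod>i. \<Prod>r<4. 1 + fps_X ^ (k * Suc (4 * i + r)))"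
    using assms by (intro euler_prod_group) auto
  have f2k: "\<f> (2 * k) = (\<Prod>i. \<Prod>r<2. 1 + fps_X ^ (2 * k * Suc (2 * i + r)))"
    using k by (intro euler_prod_group) auto
  have le: "Suc i \<le> c * k * Suc (s * i + r)" if "c > 0" "s > 0" for c s i r :: nat
  proof -
    have "i \<le> s * i" using that by simp
    hence "Suc i \<le> Suc (s * i + r)" by linarith
    also have "\<dots> \<le> c * k * Suc (s * i + r)"
      using that assms by (intro mult_Suc_ge) simp
    finally show ?thesis .
  qed
  \<comment> \<open>The theta product lacks the factors with exponents 2k modulo 4k. Multiplying by
    f_2k supplies them together with a second set of multiples of 4k, which is f_4k. Since f_2k =
    f_k^2 and f_4k = f_k^4, cancelling f_k^2 leaves the cube.\<close>
  have "theta k (3 * k) * \<f> (2 * k) = \<f> k * \<f> (4 * k)"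
    unfolding theta_prod[OF assms k(1)] f2k fk euler_prod_def[of "4 * k"]
  proof (subst (1 2) fps_prodinf_mult [symmetric])
    show "eq_upto (Suc i) (\<Prod>r<4. 1 + fps_X ^ (k * Suc (4 * i + r)) :: bit fps) 1" for i
      using le[of 1 4] by (intro eq_upto_prod_1 eq_upto_add_X_power) simp
    show "eq_upto (Suc i) (\<Prod>r<2. 1 + fps_X ^ (2 * k * Suc (2 * i + r)) :: bit fps) 1" for i
      using le[of 2 2] by (intro eq_upto_prod_1 eq_upto_add_X_power) simp
    show "(\<Prod>i. (1 + fps_X ^ (k + (k + 3 * k) * i)) * (1 + fps_X ^ (3 * k + (k + 3 * k) * i)) *
           (1 + fps_X ^ ((k + 3 * k) * Suc i)) * (\<Prod>r<2. 1 + fps_X ^ (2 * k * Suc (2 * i + r))) :: bit fps) =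
        (\<Prod>i. (\<Prod>r<4. 1 + fps_X ^ (k * Suc (4 * i + r))) * (1 + fps_X ^ (4 * k * Suc i)))"
    proof (intro arg_cong[where f = prodinf] ext)
      fix i
      have e: "k + (k + 3 * k) * i = k * Suc (4 * i + 0)" "2 * k * Suc (2 * i + 0) = k * Suc (4 * i + 1)"
        "3 * k + (k + 3 * k) * i = k * Suc (4 * i + 2)" "(k + 3 * k) * Suc i = k * Suc (4 * i + 3)"
        "2 * k * Suc (2 * i + 1) = 4 * k * Suc i"
        by (simp_all add: algebra_simps)
      show "(1 + fps_X ^ (k + (k + 3 * k) * i)) * (1 + fps_X ^ (3 * k + (k + 3 * k) * i)) *
           (1 + fps_X ^ ((k + 3 * k) * Suc i)) * (\<Prod>r<2. 1 + fps_X ^ (2 * k * Suc (2 * i + r))) =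
        (\<Prod>r<4. 1 + fps_X ^ (k * Suc (4 * i + r))) * (1 + fps_X ^ (4 * k * Suc i) :: bit fps)"
        unfolding prod_lessThan_numeral e by (simp only: ac_simps)
    qed
  qed (rule theta_prod_eq_upto[OF assms k(1)] euler_factor_eq_upto[OF k(3)])+
  also have "\<f> (4 * k) = \<f> k * \<f> k * (\<f> k * \<f> k)"
    using euler_prod_square[OF assms] euler_prod_square[OF k(2)] by simp
  finally have "theta k (3 * k) * (\<f> k * \<f> k) = \<f> k ^ 3 * (\<f> k * \<f> k)"
    by (simp add: euler_prod_square[OF assms] power3_eq_cube ac_simps)
  thus ?thesis
    using euler_prod_nonzero[OF assms] by simp
qed

text \<open>The residues 1, 4, 0 and 2, 3, 0 modulo 5 make up f_1, with the multiples of 5 occurring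
  once more as f_5.\<close>

lemma theta_1_4_mult_theta_2_3: "theta 1 4 * theta 2 3 = \<f> 1 * \<f> 5"
proof -
  have f1: "\<f> 1 = (\<Prod>i. \<Prod>r<5. 1 + fps_X ^ (1 * Suc (5 * i + r)))"
    by (intro euler_prod_group) auto
  have t: "theta 1 4 = (\<Prod>i. (1 + fps_X ^ (1 + (1 + 4) * i)) * (1 + fps_X ^ (4 + (1 + 4) * i)) *
           (1 + fps_X ^ ((1 + 4) * Suc i)) :: bit fps)"
    "theta 2 3 = (\<Prod>i. (1 + fps_X ^ (2 + (2 + 3) * i)) * (1 + fps_X ^ (3 + (2 + 3) * i)) *
           (1 + fps_X ^ ((2 + 3) * Suc i)) :: bit fps)"
    by (rule theta_prod; simp)+
  show ?thesis
    unfolding t f1 euler_prod_def[of 5]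
  proof (subst (1 2) fps_prodinf_mult [symmetric])
    show "eq_upto (Suc i) (\<Prod>r<5. 1 + fps_X ^ (1 * Suc (5 * i + r)) :: bit fps) 1" for i
      by (intro eq_upto_prod_1 eq_upto_add_X_power) simp
    show "eq_upto (Suc i) (1 + fps_X ^ (5 * Suc i) :: bit fps) 1" for i
      by (rule euler_factor_eq_upto) simp
    show "(\<Prod>i. (1 + fps_X ^ (1 + (1 + 4) * i)) * (1 + fps_X ^ (4 + (1 + 4) * i)) *
           (1 + fps_X ^ ((1 + 4) * Suc i)) * ((1 + fps_X ^ (2 + (2 + 3) * i)) * (1 + fps_X ^ (3 + (2 + 3) * i)) *
           (1 + fps_X ^ ((2 + 3) * Suc i))) :: bit fps) =
        (\<Prod>i. (\<Prod>r<5. 1 + fps_X ^ (1 * Suc (5 * i + r))) * (1 + fps_X ^ (5 * Suc i)))"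
    proof (intro arg_cong[where f = prodinf] ext)
      fix i :: nat
      have e: "1 + (1 + 4) * i = 1 * Suc (5 * i + 0)" "2 + (2 + 3) * i = 1 * Suc (5 * i + 1)"
        "3 + (2 + 3) * i = 1 * Suc (5 * i + 2)" "4 + (1 + 4) * i = 1 * Suc (5 * i + 3)"
        "(1 + 4) * Suc i = 1 * Suc (5 * i + 4)" "(2 + 3) * Suc i = 5 * Suc i"
        by simp_all
      show "(1 + fps_X ^ (1 + (1 + 4) * i)) * (1 + fps_X ^ (4 + (1 + 4) * i)) *
           (1 + fps_X ^ ((1 + 4) * Suc i)) * ((1 + fps_X ^ (2 + (2 + 3) * i)) * (1 + fps_X ^ (3 + (2 + 3) * i)) *
           (1 + fps_X ^ ((2 + 3) * Suc i))) =
        (\<Prod>r<5. 1 + fps_X ^ (1 * Suc (5 * i + r))) * (1 + fps_X ^ (5 * Suc i) :: bit fps)"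
        unfolding prod_lessThan_numeral e by (simp only: ac_simps)
    qed
  qed (rule theta_prod_eq_upto; simp)+
qed

declare One_nat_def [simp del]

section \<open>Dissections of theta series by residue classes and involutions\<close>

lemma gf_split:
  assumes fin: "finite I" "finite_weight UNIV w" and bij: "bij_betw (\<lambda>(r, y). \<phi> r y) (I \<times> UNIV) UNIV"
  shows "gf UNIV w = (\<Sum>r\<in>I. gf UNIV (\<lambda>y. w (\<phi> r y)))"
proof (rule fps_ext)
  fix n
  have "fps_nth (gf UNIV w) n = fps_nth (gf (I \<times> UNIV) (\<lambda>(r, y). w (\<phi> r y))) n"
    by (subst gf_reindex[OF bij]) auto
  also have "\<dots> = of_nat (card (SIGMA r:I. {y \<in> UNIV. w (\<phi> r y) = int n}))"
    unfolding gf_nth by (intro arg_cong[where f = of_nat] arg_cong[where f = card]) auto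
  also have "\<dots> = (\<Sum>r\<in>I. of_nat (card {y \<in> UNIV. w (\<phi> r y) = int n}))"
  proof (subst card_SigmaI)
    have "finite {y \<in> UNIV. w (\<phi> r y) = int n}" if "r \<in> I" for r
    proof (rule finite_weightD(2)[OF finite_weight_reindex[OF fin(2)]])
      show "inj_on (\<phi> r) UNIV"
        using bij that by (auto simp: bij_betw_def inj_on_def)
    qed simp_all
    thus "\<forall>r\<in>I. finite {y \<in> UNIV. w (\<phi> r y) = int n}" by blast
  qed (simp_all add: fin)
  finally show "fps_nth (gf UNIV w) n = fps_nth (\<Sum>r\<in>I. gf UNIV (\<lambda>y. w (\<phi> r y))) n"
    by (simp add: fps_sum_nth gf_nth)
qed

lemma gf_residues:
  fixes w :: "int \<Rightarrow> int"
  assumes "finite_weight UNIV w" "d > 0"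
  shows "gf UNIV w = (\<Sum>r<d. gf UNIV (\<lambda>c. w (int d * c + int r)))"
proof (rule gf_split)
  show "bij_betw (\<lambda>(r, c). int d * c + int r) ({..<d} \<times> UNIV) UNIV"
    by (rule bij_betw_byWitness[where f' = "\<lambda>x. (nat (x mod int d), x div int d)"])
       (use assms(2) in \<open>auto simp: nat_less_iff div_add1_eq\<close>)
qed (use assms in auto)

lemma gf_reflect:
  fixes w :: "int \<Rightarrow> int"
  shows "gf UNIV w = gf UNIV (\<lambda>c. w (e - c))"
  by (rule gf_reindex[where h = "\<lambda>c. e - c"])
     (auto intro!: bij_betw_byWitness[where f' = "\<lambda>c. e - c"])

lemma gf_translate:
  fixes w :: "int \<Rightarrow> int"
  shows "gf UNIV w = gf UNIV (\<lambda>c. w (c + e))"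
  by (rule gf_reindex[where h = "\<lambda>c. c + e"])
     (auto intro!: bij_betw_byWitness[where f' = "\<lambda>c. c - e"])

lemma sum_lessThan_numeral:
  fixes g :: "nat \<Rightarrow> 'a::comm_monoid_add"
  shows "(\<Sum>r<2. g r) = g 0 + g 1" "(\<Sum>r<3. g r) = g 0 + g 1 + g 2"
    "(\<Sum>r<5. g r) = g 0 + g 1 + g 2 + g 3 + g 4"
  by (simp_all add: eval_nat_numeral One_nat_def)

text \<open>Indices 0 and 2 modulo 3 give the even and the odd indices of \<open>theta 3 6\<close>.
  At the index 1 - 3c the weight is 9 times the weight at c, plus 1.\<close>

lemma theta_1_3_split: "theta 1 3 = theta 3 6 + fps_X * (theta 9 27 :: 'a::idom fps)"
proof -
  have fin: "finite_weight UNIV (tw 1 3)" "finite_weight UNIV (tw 3 6)" "finite_weight UNIV (tw 9 27)"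
    by (rule finite_weight_tw; simp)+
  have "theta 1 3 = (\<Sum>r<3. gf UNIV (\<lambda>c. tw 1 3 (int 3 * c + int r)) :: 'a fps)"
    unfolding theta_def by (rule gf_residues[OF fin(1)]) simp
  also have "\<dots> = gf UNIV (\<lambda>c. tw 1 3 (3 * c)) + gf UNIV (\<lambda>c. tw 1 3 (3 * c + 2)) + gf UNIV (\<lambda>c. tw 1 3 (3 * c + 1))"
    by (simp add: sum_lessThan_numeral)
  also have "gf UNIV (\<lambda>c. tw 1 3 (3 * c)) = (gf UNIV (\<lambda>c. tw 3 6 (2 * c)) :: 'a fps)"
    by (intro gf_cong tw_eqI) (simp_all add: two_tw algebra_simps)
  also have "gf UNIV (\<lambda>c. tw 1 3 (3 * c + 2)) = (gf UNIV (\<lambda>c. tw 3 6 (2 * c + 1)) :: 'a fps)"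
    by (subst gf_reflect[of _ "-1"], intro gf_cong tw_eqI) (simp_all add: two_tw algebra_simps)
  also have "gf UNIV (\<lambda>c. tw 1 3 (3 * c + 1)) = (gf UNIV (\<lambda>c. tw 9 27 c + int 1) :: 'a fps)"
    by (subst gf_reflect[of _ 0], intro gf_cong tw_eqI) (simp_all add: two_tw algebra_simps)
  also have "gf UNIV (\<lambda>c. tw 3 6 (2 * c)) + gf UNIV (\<lambda>c. tw 3 6 (2 * c + 1)) = (theta 3 6 :: 'a fps)"
    unfolding theta_def by (subst gf_residues[OF fin(2), of 2]) (simp_all add: sum_lessThan_numeral)
  also have "gf UNIV (\<lambda>c. tw 9 27 c + int 1) = (fps_X * theta 9 27 :: 'a fps)"
    unfolding theta_def gf_shift[OF fin(3), symmetric] by simp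
  finally show ?thesis .
qed

text \<open>The fixed points of the involution h form the lines k = j and k = 1 - 3j; along them the
  weight is that of \<open>theta 4 12\<close>, and that of \<open>theta 12 36\<close> plus
  1.\<close>

lemma theta_1_3_mult_theta_3_9:
  "theta 1 3 * theta 3 9 = theta 4 12 + fps_X * (theta 12 36 :: bit fps)"
proof -
  define w where "w = (\<lambda>(k, j). tw 1 3 k + tw 3 9 j)"
  have w: "w (k, j) = 2 * k * k - k + 3 * (2 * j * j - j)" for k j
  proof -
    have "tw 1 3 k = 2 * k * k - k" "tw 3 9 j = 3 * (2 * j * j - j)"
      by (rule tw_eqI; simp add: algebra_simps)+
    thus ?thesis by (simp add: w_def)
  qed
  have fin: "finite_weight UNIV (tw 1 3)" "finite_weight UNIV (tw 3 9)" "finite_weight UNIV (tw 12 36)"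
    by (rule finite_weight_tw; simp)+
  have finw: "finite_weight UNIV w"
    using finite_weight_times[OF fin(1,2)] by (simp add: w_def)
  \<comment> \<open>In the variables u = 4k - 1, v = 4j - 1 the weight n satisfies u^2 + 3v^2 = 8n + 4, and h is
    multiplication by a primitive sixth root of unity in the Eisenstein integers, up to the signs
    that keep u and v congruent to 3 modulo 4.\<close>
  define h where "h = (\<lambda>(k::int, j::int). if even (k + j) then ((3 * j - k) div 2, (k + j) div 2)
    else ((k - 3 * j + 1) div 2, (1 - k - j) div 2))"
  \<comment> \<open>Replacing k by c, where k + j is 2c or 2c + 1, makes both branches linear and
    removes the division.\<close>
  have h_even: "h (2 * c - j, j) = (2 * j - c, c)" for c j
    by (simp add: h_def)
  have h_odd: "h (2 * c + 1 - j, j) = (c + 1 - 2 * j, - c)" for c j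
    by (simp add: h_def)
  have cases: thesis if "\<And>c j. x = (2 * c - j, j) \<Longrightarrow> thesis" "\<And>c j. x = (2 * c + 1 - j, j) \<Longrightarrow> thesis"
    for x :: "int \<times> int" and thesis
  proof -
    obtain k j where x: "x = (k, j)" by fastforce
    show ?thesis
    proof (cases "even (k + j)")
      case True
      then obtain c where "k + j = 2 * c" by blast
      hence "k = 2 * c - j" by simp
      thus ?thesis using that(1) x by blast
    next
      case False
      then obtain c where "k + j = 2 * c + 1" by (elim oddE)
      hence "k = 2 * c + 1 - j" by simp
      thus ?thesis using that(2) x by blast
    qed
  qed
  have hh: "h (h x) = x" for x
  proof (rule cases[of x])
    fix c j assume "x = (2 * c - j, j)"
    thus ?thesis using h_even[of c j] h_even[of j c] by simp
  next
    fix c j assume "x = (2 * c + 1 - j, j)"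
    thus ?thesis using h_odd[of c j] h_odd[of "-j" "-c"] by (simp add: algebra_simps)
  qed
  have wh: "w (h x) = w x" for x
    by (rule cases[of x]) (simp_all only: h_even h_odd w, simp_all add: algebra_simps)
  have fixed: "{x \<in> UNIV. h x = x} = {(k, j). k = j} \<union> {(k, j). k = 1 - 3 * j}" (is "_ = ?A \<union> ?B")
  proof -
    have "h x = x \<longleftrightarrow> x \<in> ?A \<union> ?B" for x
    proof (rule cases[of x])
      fix c j assume x: "x = (2 * c - j, j)"
      \<comment> \<open>Parity separates the lines: k + j is even on k = j and odd on k = 1 - 3j, so
        each branch of h contributes one of them.\<close>
      have "2 * c - j \<noteq> 1 - 3 * j" by presburger
      thus ?thesis by (auto simp: x h_even)
    next
      fix c j assume x: "x = (2 * c + 1 - j, j)"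
      have "2 * c + 1 - j \<noteq> j" by presburger
      thus ?thesis by (auto simp: x h_odd)
    qed
    thus ?thesis by (intro set_eqI) (simp only: mem_Collect_eq UNIV_I simp_thms)
  qed
  have "theta 1 3 * theta 3 9 = (gf UNIV w :: bit fps)"
    unfolding theta_def gf_mult[OF fin(1,2)] w_def by simp
  also have "\<dots> = gf (?A \<union> ?B) w"
    unfolding fixed [symmetric] by (rule gf_involution[OF finw]) (simp_all add: hh wh)
  also have "\<dots> = gf ?A w + gf ?B w"
  proof (rule gf_Un)
    have "j \<noteq> 1 - 3 * j" for j :: int by presburger
    thus "?A \<inter> ?B = {}" by auto
  qed (rule finite_weight_subset[OF finw]; simp)+
  also have "gf ?A w = (theta 4 12 :: bit fps)"
    unfolding theta_def
  proof (rule gf_reindex)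
    show "bij_betw (\<lambda>m. (m, m)) UNIV ?A"
      by (rule bij_betw_byWitness[where f' = fst]) auto
    show "w (m, m) = tw 4 12 m" for m
      by (rule tw_eqI [symmetric]) (simp add: w algebra_simps)
  qed
  also have "gf ?B w = (gf UNIV (\<lambda>x. tw 12 36 x + int 1) :: bit fps)"
  proof (rule gf_reindex)
    show "bij_betw (\<lambda>m. (1 - 3 * m, m)) UNIV ?B"
      by (rule bij_betw_byWitness[where f' = snd]) auto
    fix m
    have "tw 12 36 m = 12 * (2 * m * m - m)"
      by (rule tw_eqI) (simp add: algebra_simps)
    thus "w (1 - 3 * m, m) = tw 12 36 m + int 1"
      by (simp add: w algebra_simps)
  qed
  also have "\<dots> = fps_X * theta 12 36"
    unfolding theta_def gf_shift[OF fin(3), symmetric] by simp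
  finally show ?thesis .
qed

text \<open>Split the index modulo 5. Classes 0 and 3 are the even and odd m in 25m^2 - 5m, classes
  1 and 2 those in 25m^2 + 15m + 2; class 4 carries 25 times the original weight plus 6. The glued
  form matches the fixed lines found for \<open>theta 1 4 * theta 2 3\<close>.\<close>

lemma theta_2_6_residues:
  "theta 2 6 = gf UNIV (\<lambda>m. 25 * m * m - 5 * m) + gf UNIV (\<lambda>m. 25 * m * m + 15 * m + 2) +
    fps_X ^ 6 * (theta 50 150 :: 'a::idom fps)"
proof -
  have fin: "finite_weight UNIV (tw 2 6)" "finite_weight UNIV (tw 50 150)"
    by (rule finite_weight_tw; simp)+
  have bound: "\<bar>m\<bar> \<le> m * m" for m :: int
    using tw_ge[of 1 1 m] tw_eqI[of "m * m" 1 m 1] by (simp add: algebra_simps)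
  have fin': "finite_weight UNIV (\<lambda>m::int. 25 * m * m - 5 * m)" (is "finite_weight _ ?u")
    "finite_weight UNIV (\<lambda>m::int. 25 * m * m + 15 * m + 2)" (is "finite_weight _ ?v")
  proof -
    have "\<bar>m\<bar> \<le> ?u m" "\<bar>m\<bar> \<le> ?v m" for m
      using bound[of m] by auto
    thus "finite_weight UNIV ?u" "finite_weight UNIV ?v"
      by (auto intro: finite_weight_UNIV_int)
  qed
  have tw26: "tw 2 6 m = 4 * m * m - 2 * m" for m
    by (rule tw_eqI) (simp add: algebra_simps)
  have "gf UNIV ?u + gf UNIV ?v + fps_X ^ 6 * theta 50 150 =
      gf UNIV (\<lambda>c. ?u (2 * c)) + gf UNIV (\<lambda>c. ?v (2 * c)) + gf UNIV (\<lambda>c. ?v (2 * c + 1)) +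
      gf UNIV (\<lambda>c. ?u (2 * c + 1)) + (gf UNIV (\<lambda>c. tw 50 150 c + int 6) :: 'a fps)"
    unfolding theta_def gf_shift[OF fin(2)] gf_residues[OF fin'(1) pos2] gf_residues[OF fin'(2) pos2]
      sum_lessThan_numeral by (simp add: add_ac)
  also have "gf UNIV (\<lambda>c. ?u (2 * c)) = (gf UNIV (\<lambda>c. tw 2 6 (5 * c)) :: 'a fps)"
    by (intro gf_cong) (simp_all add: tw26 algebra_simps)
  also have "gf UNIV (\<lambda>c. ?v (2 * c)) = (gf UNIV (\<lambda>c. tw 2 6 (5 * c + 1)) :: 'a fps)"
    by (intro gf_cong) (simp_all add: tw26 algebra_simps)
  also have "gf UNIV (\<lambda>c. ?v (2 * c + 1)) = (gf UNIV (\<lambda>c. tw 2 6 (5 * c + 2)) :: 'a fps)"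
    by (subst gf_reflect[of _ "-1"], intro gf_cong) (simp_all add: tw26 algebra_simps)
  also have "gf UNIV (\<lambda>c. ?u (2 * c + 1)) = (gf UNIV (\<lambda>c. tw 2 6 (5 * c + 3)) :: 'a fps)"
    by (subst gf_reflect[of _ "-1"], intro gf_cong) (simp_all add: tw26 algebra_simps)
  also have "gf UNIV (\<lambda>c. tw 50 150 c + int 6) = (gf UNIV (\<lambda>c. tw 2 6 (5 * c + 4)) :: 'a fps)"
  proof (subst gf_translate[of _ 1], intro gf_cong)
    have "tw 50 150 c = 25 * tw 2 6 c" for c
      using tw_scale[of 25 2 6 c] by simp
    thus "tw 50 150 (c + 1) + int 6 = tw 2 6 (5 * c + 4)" for c
      by (simp only: tw26) (simp add: algebra_simps)
  qed simp
  also have "gf UNIV (\<lambda>c. tw 2 6 (5 * c)) + gf UNIV (\<lambda>c. tw 2 6 (5 * c + 1)) + gf UNIV (\<lambda>c. tw 2 6 (5 * c + 2)) +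
      gf UNIV (\<lambda>c. tw 2 6 (5 * c + 3)) + gf UNIV (\<lambda>c. tw 2 6 (5 * c + 4)) = (theta 2 6 :: 'a fps)"
    unfolding theta_def by (subst gf_residues[OF fin(1), of 5]) (simp_all add: sum_lessThan_numeral)
  finally show ?thesis ..
qed

text \<open>The pairs (k, j) are split by k + 2j modulo 5. Involutions reduce classes 0 and 2 to a
  line each and classes 3 and 4 to nothing; class 1 is a copy of the full lattice with weight 5w +
  1.\<close>

lemma theta_1_4_mult_theta_2_3_residues:
  "theta 1 4 * theta 2 3 = gf UNIV (\<lambda>m. 25 * m * m - 5 * m) + gf UNIV (\<lambda>m. 25 * m * m + 15 * m + 2) +
    fps_X * ((theta 1 4 * theta 2 3) oo fps_X ^ 5 :: bit fps)"
proof -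
  define w where "w = (\<lambda>(k, j). tw 1 4 k + tw 2 3 j)"
  have two_w: "2 * w (k, j) = 5 * k * k - 3 * k + 5 * j * j - j" for k j
    unfolding w_def prod.case distrib_left two_tw by (simp add: algebra_simps)
  have cancel: "x = y" if "2 * x = 2 * y" for x y :: int
    using that by simp
  have fin: "finite_weight UNIV (tw 1 4)" "finite_weight UNIV (tw 2 3)"
    by (rule finite_weight_tw; simp)+
  have finw: "finite_weight UNIV w"
    using finite_weight_times[OF fin] by (simp add: w_def)
  have finw5: "finite_weight UNIV (\<lambda>x. 5 * w x)"
    unfolding finite_weight_def
  proof (intro conjI allI ballI)
    show "0 \<le> 5 * w x" for x using finite_weightD(1)[OF finw] by simp
    show "finite {x \<in> UNIV. 5 * w x = n}" for n
      by (rule finite_subset[OF _ finite_weightD(2)[OF finw, of "n div 5"]]) auto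
  qed
  have prod: "theta 1 4 * theta 2 3 = (gf UNIV w :: bit fps)"
    unfolding theta_def gf_mult[OF fin] w_def by simp
  \<comment> \<open>The coordinates satisfy k + 2j = 5a + r. For u = 4k - 2j - 1 and v = 2k + 4j - 1
    the class r fixes u and v modulo 5, as 4r - 1 and 2r - 1; this decides which swap or sign change
    maps the class to itself.\<close>
  define \<phi> where "\<phi> = (\<lambda>r (a, j). (5 * a - 2 * j + int r, j))"
  have bij: "bij_betw (\<lambda>(r, y). \<phi> r y) ({..<5} \<times> UNIV) UNIV"
  proof (rule bij_betw_byWitness[where f' = "\<lambda>(k, j). (nat ((k + 2 * j) mod 5), ((k + 2 * j) div 5, j))"])
    have "(5 * a + int r) mod 5 = int r" "(5 * a + int r) div 5 = a" if "r < 5" for a r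
      using that by simp_all
    thus "\<forall>x\<in>{..<5} \<times> UNIV. (\<lambda>(k, j). (nat ((k + 2 * j) mod 5), ((k + 2 * j) div 5, j)))
        (case x of (r, y) \<Rightarrow> \<phi> r y) = x"
      by (simp add: \<phi>_def)
  qed (auto simp: \<phi>_def nat_less_iff, presburger)
  have two_w\<phi>: "2 * w (\<phi> r (a, j)) = 5 * (5 * a - 2 * j + int r) * (5 * a - 2 * j + int r) -
      3 * (5 * a - 2 * j + int r) + 5 * j * j - j" for r a j
    unfolding \<phi>_def prod.case two_w ..
  have fin\<phi>: "finite_weight UNIV (\<lambda>y. w (\<phi> r y))" for r
    by (rule finite_weight_reindex[OF finw, of "\<phi> r"]) (auto simp: \<phi>_def inj_on_def)
  have involution: "gf UNIV (\<lambda>y. w (\<phi> r y)) = (gf {y. h y = y} (\<lambda>y. w (\<phi> r y)) :: bit fps)"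
    if "\<And>a j. h (h (a, j)) = (a, j)" "\<And>a j. 2 * w (\<phi> r (h (a, j))) = 2 * w (\<phi> r (a, j))" for r h
    using gf_involution[OF fin\<phi>, of h r] that by auto
  \<comment> \<open>With x = 10k - 3 and y = 10j - 1 the weight n satisfies x^2 + y^2 = 40n + 10, and dividing by a
    Gaussian prime of norm 5 gives u = 4k - 2j - 1, v = 2k + 4j - 1 with u^2 + v^2 = 8n + 2.
    The four involutions below are (u, v) to (v, u), (-v, -u), (u, -v) and (-u, v); in the remaining
    class 5 divides u^2 + v^2 and one can divide by the prime once more.\<close>
  have r0: "gf UNIV (\<lambda>y. w (\<phi> 0 y)) = (gf UNIV (\<lambda>m. 25 * m * m - 5 * m) :: bit fps)"
  proof -
    define h :: "int \<times> int \<Rightarrow> int \<times> int" where "h = (\<lambda>(a, j). (2 * a - j, 3 * a - 2 * j))"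
    have "gf UNIV (\<lambda>y. w (\<phi> 0 y)) = (gf {y. h y = y} (\<lambda>y. w (\<phi> 0 y)) :: bit fps)"
      by (rule involution) (simp_all only: h_def prod.case two_w\<phi>, simp_all add: algebra_simps)
    also have "\<dots> = gf UNIV (\<lambda>m. 25 * m * m - 5 * m)"
    proof (rule gf_reindex)
      show "bij_betw (\<lambda>m. (m, m)) UNIV {y. h y = y}"
        by (rule bij_betw_byWitness[where f' = fst]) (auto simp: h_def)
      have "2 * w (\<phi> 0 (m, m)) = 2 * (25 * m * m - 5 * m)" for m
        unfolding two_w\<phi> by (simp add: algebra_simps)
      thus "w (\<phi> 0 (m, m)) = 25 * m * m - 5 * m" for m by (rule cancel)
    qed
    finally show ?thesis .
  qed
  have r2: "gf UNIV (\<lambda>y. w (\<phi> 2 y)) = (gf UNIV (\<lambda>m. 25 * m * m + 15 * m + 2) :: bit fps)"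
  proof -
    define h :: "int \<times> int \<Rightarrow> int \<times> int" where "h = (\<lambda>(a, j). (j - 2 * a - 1, 2 * j - 3 * a - 1))"
    have "gf UNIV (\<lambda>y. w (\<phi> 2 y)) = (gf {y. h y = y} (\<lambda>y. w (\<phi> 2 y)) :: bit fps)"
      by (rule involution) (simp_all only: h_def prod.case two_w\<phi>, simp_all add: algebra_simps)
    also have "\<dots> = gf UNIV (\<lambda>m. 25 * m * m + 15 * m + 2)"
    proof (rule gf_reindex)
      show "bij_betw (\<lambda>m. (m, 3 * m + 1)) UNIV {y. h y = y}"
        by (rule bij_betw_byWitness[where f' = fst]) (auto simp: h_def)
      have "2 * w (\<phi> 2 (m, 3 * m + 1)) = 2 * (25 * m * m + 15 * m + 2)" for m
        unfolding two_w\<phi> by (simp add: algebra_simps)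
      thus "w (\<phi> 2 (m, 3 * m + 1)) = 25 * m * m + 15 * m + 2" for m by (rule cancel)
    qed
    finally show ?thesis .
  qed
  have r3: "gf UNIV (\<lambda>y. w (\<phi> 3 y)) = (0 :: bit fps)"
  proof -
    define h :: "int \<times> int \<Rightarrow> int \<times> int" where "h = (\<lambda>(a, j). (- 1 - a, j - 4 * a - 2))"
    have "gf UNIV (\<lambda>y. w (\<phi> 3 y)) = (gf {y. h y = y} (\<lambda>y. w (\<phi> 3 y)) :: bit fps)"
      by (rule involution) (simp_all only: h_def prod.case two_w\<phi>, simp_all add: algebra_simps)
    also have "{y. h y = y} = {}"
    proof -
      \<comment> \<open>Here v = 10a + 5 changes sign, and an odd number is not its own
        negative.\<close>
      have "- 1 - a \<noteq> a" for a :: int by presburger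
      thus ?thesis by (auto simp: h_def)
    qed
    finally show ?thesis by (simp add: gf_def fps_zero_def)
  qed
  have r4: "gf UNIV (\<lambda>y. w (\<phi> 4 y)) = (0 :: bit fps)"
  proof -
    define h :: "int \<times> int \<Rightarrow> int \<times> int" where "h = (\<lambda>(a, j). (a, 4 * a - j + 3))"
    have "gf UNIV (\<lambda>y. w (\<phi> 4 y)) = (gf {y. h y = y} (\<lambda>y. w (\<phi> 4 y)) :: bit fps)"
      by (rule involution) (simp_all only: h_def prod.case two_w\<phi>, simp_all add: algebra_simps)
    also have "{y. h y = y} = {}"
    proof -
      \<comment> \<open>Now u changes sign, and it is odd as well.\<close>
      have "4 * a - j + 3 \<noteq> j" for a j :: int by presburger
      thus ?thesis by (auto simp: h_def)
    qed
    finally show ?thesis by (simp add: gf_def fps_zero_def)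
  qed
  have r1: "gf UNIV (\<lambda>y. w (\<phi> 1 y)) = (fps_X * (gf UNIV w oo fps_X ^ 5) :: bit fps)"
  proof -
    have "gf UNIV (\<lambda>y. w (\<phi> 1 y)) = (gf UNIV (\<lambda>x. 5 * w x + int 1) :: bit fps)"
    proof (rule gf_reindex)
      \<comment> \<open>After applying \<open>\<phi> 1\<close>, in x = 10k - 3 and y = 10j - 1, this
        is multiplication of x + iy by -2 + i, of norm 5, and 5 (40n + 10) = 40 (5n + 1) +
        10.\<close>
      show "bij_betw (\<lambda>(k, j). (- j, k - 2 * j)) (UNIV :: (int \<times> int) set) UNIV"
        by (rule bij_betw_byWitness[where f' = "\<lambda>(a, j). (j - 2 * a, - a)"]) auto
      fix x :: "int \<times> int"
      obtain k j where x: "x = (k, j)" by fastforce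
      have "2 * w (\<phi> 1 (- j, k - 2 * j)) = 5 * (2 * w (k, j)) + 2"
        unfolding two_w\<phi> two_w by (simp add: algebra_simps)
      thus "w (\<phi> 1 (case x of (k, j) \<Rightarrow> (- j, k - 2 * j))) = 5 * w x + int 1"
        by (simp add: x)
    qed
    also have "\<dots> = fps_X ^ 1 * gf UNIV (\<lambda>x. 5 * w x)"
      by (rule gf_shift [symmetric]) (rule finw5)
    also have "gf UNIV (\<lambda>x. 5 * w x) = (gf UNIV w oo fps_X ^ 5 :: bit fps)"
      by (subst gf_compose_X_power) simp_all
    finally show ?thesis by simp
  qed
  have "(gf UNIV w :: bit fps) = (\<Sum>r<5. gf UNIV (\<lambda>y. w (\<phi> r y)))"
    by (rule gf_split[OF _ finw bij]) simp
  thus ?thesis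
    unfolding prod sum_lessThan_numeral r0 r1 r2 r3 r4 by (simp only: add_ac add_0_right add_0_left)
qed

text \<open>Descent: the constant coefficient is 0, and coefficient m + 1 is either 0 or the
  coefficient at m / c, a smaller index.\<close>

lemma fps_eq_X_mult_compose_imp_zero:
  assumes "f = fps_X * (f oo fps_X ^ c)" "c > 0"
  shows "f = (0 :: 'a::idom fps)"
proof (rule fps_ext)
  fix n
  show "fps_nth f n = fps_nth 0 n"
  proof (induction n rule: less_induct)
    case (less n)
    have "fps_nth f n = fps_nth (fps_X * (f oo fps_X ^ c)) n"
      using assms(1) by simp
    also have "\<dots> = 0"
    proof (cases n)
      case (Suc m)
      have "m div c \<le> m" by (rule div_le_dividend)
      with Suc less[of "m div c"] show ?thesis
        by (simp add: fps_nth_compose_X_power)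
    qed simp
    finally show ?case by simp
  qed
qed

text \<open>Both sides solve F = P + q F(q^5), where P is the sum of the two glued series, so their
  difference \<open>D\<close> satisfies D = q D(q^5) and vanishes.\<close>

lemma theta_1_4_mult_theta_2_3_eq:
  "theta 1 4 * theta 2 3 = theta 2 6 + fps_X * (theta 10 30 :: bit fps)"
proof -
  let ?Z = "theta 1 4 * theta 2 3 :: bit fps"
  define D where "D = ?Z + theta 2 6 + fps_X * theta 10 30"
  have X5: "fps_nth (fps_X ^ 5 :: bit fps) 0 = 0" by simp
  have comp: "theta 2 6 oo fps_X ^ 5 = (theta 10 30 :: bit fps)" "theta 10 30 oo fps_X ^ 5 = (theta 50 150 :: bit fps)"
    using theta_compose_X_power[of 5 2 6, where ?'a = bit] theta_compose_X_power[of 5 10 30, where ?'a = bit]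
    by simp_all
  have "D oo fps_X ^ 5 = (?Z oo fps_X ^ 5) + theta 10 30 + fps_X ^ 5 * theta 50 150"
    unfolding D_def fps_compose_add_distrib fps_compose_mult_distrib[OF X5, of fps_X "theta 10 30"] comp
      fps_X_fps_compose_startby0[OF X5] ..
  hence "fps_X * (D oo fps_X ^ 5) = fps_X * (?Z oo fps_X ^ 5) + fps_X * theta 10 30 + fps_X ^ 6 * theta 50 150"
    by (simp add: distrib_left mult.assoc [symmetric] flip: power_Suc)
  moreover have "D = fps_X * (?Z oo fps_X ^ 5) + fps_X * theta 10 30 + fps_X ^ 6 * theta 50 150"
  proof -
    have "(a + b + x) + (a + b + y) + z = x + z + y" for a b x y z :: "bit fps"
    proof -
      have "(a + b + x) + (a + b + y) + z = (a + a) + (b + b) + (x + z + y)"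
        by (simp only: add_ac)
      thus ?thesis by simp
    qed
    thus ?thesis
      unfolding D_def theta_2_6_residues by (subst theta_1_4_mult_theta_2_3_residues)
  qed
  ultimately have "D = fps_X * (D oo fps_X ^ 5)" by simp
  hence "D = 0"
    by (rule fps_eq_X_mult_compose_imp_zero) simp
  thus ?thesis
    unfolding D_def add.assoc bit_fps_add_eq_0_iff .
qed

section \<open>Generating functions of partitions\<close>

definition rd_factor :: "nat \<Rightarrow> nat \<Rightarrow> nat \<Rightarrow> 'a::comm_ring_1 fps" where
  "rd_factor s t i = (if s dvd Suc i then 1 else (\<Sum>j<t. fps_X ^ (j * Suc i)))"

lemma sum_mset_sum: "finite K \<Longrightarrow> sum_mset (\<Sum>k\<in>K. M k) = (\<Sum>k\<in>K. sum_mset (M k))"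
  by (induction K rule: finite_induct) auto

text \<open>A partition is encoded by its multiplicities on the admissible parts up to N; parts of a
  partition of n do not exceed n, so any N >= n serves.\<close>

lemma p_RD_eq_card_PiE:
  fixes s t n N :: nat
  assumes "t > 0" "n \<le> N"
  defines "K \<equiv> {k \<in> {1..N}. \<not> s dvd k}"
  shows "p_RD s t n = card {g \<in> PiE K (\<lambda>_. {..<t}). (\<Sum>k\<in>K. g k * k) = n}"
proof -
  let ?S = "{P \<in> int_partitions n. (\<forall>k \<in># P. \<not> s dvd k) \<and> (\<forall>k \<in># P. \<not> count P k \<ge> t)}"
  let ?T = "{g \<in> PiE K (\<lambda>_. {..<t}). (\<Sum>k\<in>K. g k * k) = n}"
  let ?M = "\<lambda>g. \<Sum>k\<in>K. replicate_mset (g k) k"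
  have fin: "finite K" by (simp add: K_def)
  have count_M: "count (?M g) k = (if k \<in> K then g k else 0)" for g k
    using fin by (simp add: count_sum)
  have sum_M: "sum_mset (?M g) = (\<Sum>k\<in>K. g k * k)" for g
    using fin by (simp add: sum_mset_sum)
  have S_subset: "k \<in> K" if "P \<in> ?S" "k \<in># P" for P k
  proof -
    have "k \<le> sum_mset P" using that(2) by (metis le_add1 insert_DiffM sum_mset.add_mset)
    moreover have "k \<noteq> 0" using that by (auto simp: int_partitions_def intro: gr0I)
    ultimately show ?thesis
      using that assms(2) by (auto simp: int_partitions_def K_def)
  qed
  have M_count: "?M (restrict (count P) K) = P" if "P \<in> ?S" for P
  proof (rule multiset_eqI)
    fix k
    show "count (?M (restrict (count P) K)) k = count P k"
      unfolding count_M using S_subset[OF that, of k] by (auto simp: count_eq_zero_iff)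
  qed
  have "bij_betw (\<lambda>P. restrict (count P) K) ?S ?T"
  proof (rule bij_betw_byWitness[where f' = ?M])
    show "\<forall>P\<in>?S. ?M (restrict (count P) K) = P"
      using M_count by blast
    show "\<forall>g\<in>?T. restrict (count (?M g)) K = g"
      by (auto simp: count_M PiE_def extensional_def fun_eq_iff)
    show "(\<lambda>P. restrict (count P) K) ` ?S \<subseteq> ?T"
    proof (intro image_subsetI)
      fix P assume P: "P \<in> ?S"
      have "count P k < t" for k
        using P assms(1) by (cases "k \<in># P") (auto simp: not_in_iff)
      moreover have "(\<Sum>k\<in>K. restrict (count P) K k * k) = n"
        using sum_M[of "restrict (count P) K"] P unfolding M_count[OF P] by (simp add: int_partitions_def)
      ultimately show "restrict (count P) K \<in> ?T"
        by auto
    qed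
    show "?M ` ?T \<subseteq> ?S"
    proof (intro image_subsetI)
      fix g assume g: "g \<in> ?T"
      have mem: "k \<in> K" if "k \<in># ?M g" for k
        using that count_M[of g k] by (metis count_greater_zero_iff less_irrefl)
      have "0 \<notin># ?M g" using mem[of 0] by (auto simp: K_def)
      moreover have "\<not> s dvd k \<and> count (?M g) k < t" if "k \<in># ?M g" for k
      proof
        show "\<not> s dvd k" using mem[OF that] by (simp add: K_def)
        show "count (?M g) k < t" using mem[OF that] g unfolding count_M by (auto simp: PiE_def)
      qed
      moreover have "sum_mset (?M g) = n"
        using sum_M[of g] g by simp
      ultimately show "?M g \<in> ?S"
        by (simp add: int_partitions_def not_le)
    qed
  qed
  thus ?thesis
    unfolding p_RD_def by (rule bij_betw_same_card)
qed

lemma p_RD_generating_function: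
  assumes "t > 0" "n \<le> N"
  shows "fps_nth (\<Prod>i<N. rd_factor s t i) n = (of_nat (p_RD s t n) :: 'a::comm_ring_1)"
proof -
  define K where "K = {k \<in> {1..N}. \<not> s dvd k}"
  have fin: "finite K" by (simp add: K_def)
  have "(\<Prod>i<N. rd_factor s t i :: 'a fps) =
      (\<Prod>k\<in>{1..N}. if s dvd k then 1 else (\<Sum>j<t. fps_X ^ (j * k)))"
    unfolding rd_factor_def
    by (rule prod.reindex_bij_witness[of _ "\<lambda>k. k - 1" Suc]) auto
  also have "\<dots> = (\<Prod>k\<in>K. \<Sum>j<t. fps_X ^ (j * k))"
    unfolding K_def by (rule prod.mono_neutral_cong_right) auto
  also have "\<dots> = (\<Sum>g\<in>PiE K (\<lambda>_. {..<t}). \<Prod>k\<in>K. fps_X ^ (g k * k))"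
    by (rule prod_sum_PiE) (auto simp: fin)
  also have "\<dots> = (\<Sum>g\<in>PiE K (\<lambda>_. {..<t}). fps_X ^ (\<Sum>k\<in>K. g k * k))"
    by (simp add: power_sum)
  finally have "fps_nth (\<Prod>i<N. rd_factor s t i :: 'a fps) n =
      (\<Sum>g\<in>PiE K (\<lambda>_. {..<t}). if (\<Sum>k\<in>K. g k * k) = n then 1 else 0)"
    by (simp add: fps_sum_nth eq_commute)
  also have "\<dots> = of_nat (card {g \<in> PiE K (\<lambda>_. {..<t}). (\<Sum>k\<in>K. g k * k) = n})"
    using fin by (simp add: sum.If_cases finite_PiE Int_def)
  also have "\<dots> = of_nat (p_RD s t n)"
    unfolding K_def p_RD_eq_card_PiE[OF assms] ..
  finally show ?thesis .
qed

lemma rd_factor_eq_upto: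
  assumes "t > 0"
  shows "eq_upto (Suc i) (rd_factor s t i :: 'a::comm_ring_1 fps) 1"
proof -
  have "fps_nth (\<Sum>j<t. (fps_X :: 'a fps) ^ (j * Suc i)) n = fps_nth 1 n" if n: "n < Suc i" for n
  proof -
    have "n = j * Suc i \<longleftrightarrow> j = 0 \<and> n = 0" for j
      using n by (cases j) auto
    hence "fps_nth (\<Sum>j<t. (fps_X :: 'a fps) ^ (j * Suc i)) n = (\<Sum>j<t. if j = 0 \<and> n = 0 then 1 else 0)"
      unfolding fps_sum_nth fps_X_power_nth by (simp only:)
    also have "\<dots> = fps_nth 1 n"
      using assms by (simp add: sum.delta)
    finally show ?thesis .
  qed
  thus ?thesis by (simp add: eq_upto_def rd_factor_def)
qed

definition rd_series :: "nat \<Rightarrow> nat \<Rightarrow> bit fps" where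
  "rd_series s t = (\<Prod>i. rd_factor s t i)"

lemma rd_series_nth: "t > 0 \<Longrightarrow> fps_nth (rd_series s t) n = of_nat (p_RD s t n)"
  unfolding rd_series_def
  by (subst fps_prodinf_nth[where N = "Suc n"])
     (simp_all add: rd_factor_eq_upto p_RD_generating_function del: prod.lessThan_Suc)

text \<open>Summing the geometric series turns G times f_1 / f_s into f_t / f_st, where both
  quotients are products over the indices prime to divisibility by s, that is, those that s does not
  divide.\<close>

lemma rd_series_euler_prod:
  assumes s: "s > 0" and t: "t > 0"
  shows "rd_series s t * \<f> 1 * \<f> (s * t) = \<f> s * \<f> t"
proof -
  \<comment> \<open>\<open>u\<close> keeps the factors of f_k whose index s does not divide,
    \<open>v\<close> the others; the latter multiply to f_sk.\<close>
  define u where "u k i = (if s dvd Suc i then 1 else 1 + fps_X ^ (k * Suc i) :: bit fps)" for k i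
  define v where "v k i = (if s dvd Suc i then 1 + fps_X ^ (k * Suc i) else 1 :: bit fps)" for k i
  have u: "eq_upto (Suc i) (u k i) 1" and v: "eq_upto (Suc i) (v k i) 1" if "k > 0" for k i
    using euler_factor_eq_upto[OF that, of i] by (auto simp: u_def v_def)
  have split: "\<f> k = (\<Prod>i. u k i) * \<f> (s * k)" if k: "k > 0" for k
  proof -
    have "\<f> k = (\<Prod>i. u k i * v k i)"
      unfolding euler_prod_def by (intro arg_cong[where f = prodinf] ext) (auto simp: u_def v_def)
    also have "\<dots> = (\<Prod>i. u k i) * (\<Prod>i. v k i)"
      by (rule fps_prodinf_mult[OF u[OF k] v[OF k]])
    also have "(\<Prod>i. v k i) = (\<Prod>i. \<Prod>r<s. v k (s * i + r))"
      by (rule fps_prodinf_group[OF v[OF k] s, symmetric])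
    also have "\<dots> = \<f> (s * k)"
      unfolding euler_prod_def
    proof (intro arg_cong[where f = prodinf] ext)
      fix i
      \<comment> \<open>In each block of s consecutive indices only the last one is a multiple of
        s.\<close>
      have "s dvd Suc (s * i + r) \<longleftrightarrow> r = s - 1" if "r < s" for r
      proof -
        have "s dvd Suc (s * i + r) \<longleftrightarrow> s dvd Suc r"
          using dvd_add_right_iff[of s "s * i" "Suc r"] by simp
        also have "\<dots> \<longleftrightarrow> r = s - 1"
          using that by (auto dest: dvd_imp_le)
        finally show ?thesis .
      qed
      hence "(\<Prod>r<s. v k (s * i + r)) = (\<Prod>r<s. if r = s - 1 then 1 + fps_X ^ (k * Suc (s * i + r)) else 1)"
        by (intro prod.cong) (simp_all add: v_def)
      also have "\<dots> = 1 + fps_X ^ (k * Suc (s * i + (s - 1)))"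
        using s by (simp add: prod.delta)
      also have "k * Suc (s * i + (s - 1)) = s * k * Suc i"
        using s by (cases s) (simp_all add: algebra_simps)
      finally show "(\<Prod>r<s. v k (s * i + r)) = 1 + fps_X ^ (s * k * Suc i)" .
    qed
    finally show ?thesis .
  qed
  have "rd_series s t * (\<Prod>i. u 1 i) = (\<Prod>i. rd_factor s t i * u 1 i)"
    unfolding rd_series_def using rd_factor_eq_upto[OF t] u
    by (intro fps_prodinf_mult [symmetric]) auto
  also have "(\<lambda>i. rd_factor s t i * u 1 i) = u t"
  proof
    fix i
    have "1 - (fps_X ^ Suc i) ^ t = (1 - fps_X ^ Suc i) * (\<Sum>j<t. (fps_X ^ Suc i) ^ j :: bit fps)"
      by (rule one_diff_power_eq)
    hence "1 + fps_X ^ (t * Suc i) = (\<Sum>j<t. fps_X ^ (j * Suc i)) * (1 + fps_X ^ (1 * Suc i) :: bit fps)"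
      unfolding bit_fps_diff power_mult [symmetric] by (simp only: mult.commute mult_1_right mult_1_left)
    thus "rd_factor s t i * u 1 i = u t i"
      by (cases "s dvd Suc i") (simp_all only: rd_factor_def u_def mult_1_left if_True if_False)
  qed
  finally have "rd_series s t * (\<Prod>i. u 1 i) = (\<Prod>i. u t i)" .
  moreover have "\<f> 1 = (\<Prod>i. u 1 i) * \<f> s"
    using split[of 1] by simp
  ultimately show ?thesis
    using split[OF t] by (simp add: ac_simps)
qed

section \<open>Dissections modulo 2\<close>

definition supported_on :: "nat \<Rightarrow> 'a::zero fps \<Rightarrow> bool" where
  "supported_on d f \<longleftrightarrow> (\<forall>n. \<not> d dvd n \<longrightarrow> fps_nth f n = 0)"

lemma supported_on_add:
  fixes f g :: "'a::comm_ring_1 fps"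
  shows "supported_on d f \<Longrightarrow> supported_on d g \<Longrightarrow> supported_on d (f + g)"
  by (simp add: supported_on_def)

lemma supported_on_mult:
  fixes f g :: "'a::comm_ring_1 fps"
  assumes "supported_on d f" "supported_on d g"
  shows "supported_on d (f * g)"
  unfolding supported_on_def
proof (intro allI impI)
  fix n assume n: "\<not> d dvd n"
  have "fps_nth f i * fps_nth g (n - i) = 0" if "i \<in> {0..n}" for i
  proof (cases "d dvd i")
    case True
    hence "\<not> d dvd n - i"
      using n that by (metis atLeastAtMost_iff dvd_diffD)
    thus ?thesis using assms(2) by (simp add: supported_on_def)
  next
    case False
    thus ?thesis using assms(1) by (simp add: supported_on_def)
  qed
  thus "fps_nth (f * g) n = 0"
    by (simp add: fps_mult_nth)
qed

lemma supported_on_power: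
  fixes f :: "'a::comm_ring_1 fps"
  shows "supported_on d f \<Longrightarrow> supported_on d (f ^ m)"
proof (induction m)
  case 0
  show ?case by (auto simp: supported_on_def intro: gr0I)
next
  case (Suc m)
  thus ?case by (simp add: supported_on_mult)
qed

text \<open>Through theta series substitution merely scales weights, so no infinite product has to
  be composed.\<close>

lemma euler_prod_compose: "k > 0 \<Longrightarrow> c > 0 \<Longrightarrow> \<f> k oo fps_X ^ c = \<f> (c * k)"
  by (simp add: euler_prod_eq_theta theta_compose_X_power mult.left_commute)

lemma supported_on_euler_prod:
  assumes "k > 0" "d dvd k"
  shows "supported_on d (\<f> k)"
proof -
  obtain c where k: "k = d * c" using assms(2) by blast
  hence "\<f> k = \<f> c oo fps_X ^ d"
    using assms(1) by (simp add: euler_prod_compose)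
  thus ?thesis
    by (simp add: supported_on_def fps_nth_compose_X_power)
qed

definition residue_part :: "nat \<Rightarrow> nat \<Rightarrow> 'a::zero fps \<Rightarrow> 'a fps" where
  "residue_part d r f = Abs_fps (\<lambda>n. if n mod d = r then fps_nth f n else 0)"

text \<open>A factor that is a series in q^d shifts exponents only by multiples of d, so it passes
  through the extraction of a residue class.\<close>

lemma residue_part_mult:
  fixes f g :: "'a::comm_ring_1 fps"
  assumes "supported_on d f"
  shows "residue_part d r (f * g) = f * residue_part d r g"
proof (rule fps_ext)
  fix n
  have "fps_nth (f * residue_part d r g) n =
      (\<Sum>i=0..n. if n mod d = r then fps_nth f i * fps_nth g (n - i) else 0)"
    unfolding fps_mult_nth
  proof (rule sum.cong)
    fix i assume i: "i \<in> {0..n}"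
    show "fps_nth f i * fps_nth (residue_part d r g) (n - i) =
        (if n mod d = r then fps_nth f i * fps_nth g (n - i) else 0)"
    proof (cases "d dvd i")
      case True
      have "(n - i) mod d = (n - i + i) mod d"
        using True by (metis add.right_neutral dvd_imp_mod_0 mod_add_right_eq)
      hence "(n - i) mod d = n mod d" using i by simp
      thus ?thesis by (simp add: residue_part_def)
    next
      case False
      thus ?thesis using assms by (simp add: supported_on_def)
    qed
  qed simp
  thus "fps_nth (residue_part d r (f * g)) n = fps_nth (f * residue_part d r g) n"
    by (simp add: residue_part_def fps_mult_nth)
qed

lemma euler_prod_1_mult_5: "\<f> 1 * \<f> 5 = \<f> 2 ^ 3 + fps_X * \<f> 10 ^ 3"
  using theta_1_4_mult_theta_2_3 theta_1_4_mult_theta_2_3_eq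
    euler_prod_cube_eq_theta[of 2] euler_prod_cube_eq_theta[of 10] by simp

lemma euler_prod_1_cube: "\<f> 1 ^ 3 = \<f> 3 + fps_X * \<f> 9 ^ 3"
  using theta_1_3_split euler_prod_cube_eq_theta[of 1] euler_prod_eq_theta[of 3] euler_prod_cube_eq_theta[of 9]
  by simp

lemma euler_prod_cubes_1_3: "\<f> 1 ^ 3 * \<f> 3 ^ 3 = \<f> 4 ^ 3 + fps_X * \<f> 12 ^ 3"
  using theta_1_3_mult_theta_3_9 euler_prod_cube_eq_theta[of 1] euler_prod_cube_eq_theta[of 3]
    euler_prod_cube_eq_theta[of 4] euler_prod_cube_eq_theta[of 12] by simp

lemma euler_prod_double: "k > 0 \<Longrightarrow> \<f> (2 * k) = \<f> k ^ 2"
  by (simp add: euler_prod_square power2_eq_square)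

lemma euler_prod_quadruple: "k > 0 \<Longrightarrow> \<f> (4 * k) = \<f> k ^ 4"
  using euler_prod_double[of k] euler_prod_double[of "2 * k"] by (simp flip: power_mult)

lemma rd_series_2_5_odd_part: "residue_part 2 1 (rd_series 2 5) = fps_X * \<f> 20"
proof -
  define G a e where "G = rd_series 2 5" and "a = \<f> 1" and "e = \<f> 5"
  have e: "\<f> 10 = e ^ 2" "\<f> 20 = e ^ 4" "\<f> 2 = a ^ 2"
    using euler_prod_double[of 5] euler_prod_quadruple[of 5] euler_prod_double[of 1]
    by (simp_all add: a_def e_def)
  have "G * a * e ^ 2 = a ^ 2 * e"
    using rd_series_euler_prod[of 2 5] by (simp add: G_def a_def [symmetric] e_def [symmetric] e)
  \<comment> \<open>Modulo 2 the quotient f_2 f_5 / (f_1 f_10) collapses to f_1 / f_5.\<close>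
  hence "(G * e) * (a * e) = a * (a * e)"
    by (simp add: power2_eq_square ac_simps)
  moreover have "a * e \<noteq> 0"
    using euler_prod_nonzero[of 1] euler_prod_nonzero[of 5] by (simp add: a_def e_def)
  ultimately have Ge: "G * e = a"
    by simp
  have ae: "a * e = \<f> 2 ^ 3 + fps_X * \<f> 10 ^ 3"
    unfolding a_def e_def by (rule euler_prod_1_mult_5)
  \<comment> \<open>Of the four factors e, one turns G into a, one completes a e, and the other two
    form the even series f_10.\<close>
  have "\<f> 20 * G = (G * e) * e * e ^ 2"
    unfolding e by (simp only: power4_eq_xxxx power2_eq_square ac_simps)
  also have "\<dots> = \<f> 2 ^ 3 * e ^ 2 + fps_X * (\<f> 10 ^ 3 * e ^ 2)"
    unfolding Ge ae by (simp add: distrib_left ac_simps)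
  also have "\<f> 10 ^ 3 * e ^ 2 = \<f> 20 * \<f> 20"
    by (simp add: e flip: power_mult power_add)
  finally have main: "\<f> 20 * G = \<f> 2 ^ 3 * \<f> 10 + fps_X * (\<f> 20 * \<f> 20)"
    by (simp add: e)
  have supp: "supported_on 2 (\<f> 2 ^ 3 * \<f> 10)" "supported_on 2 (\<f> 20)"
    by (intro supported_on_mult supported_on_power supported_on_euler_prod; simp)+
  have "supported_on 2 (\<f> 20 * \<f> 20)"
    by (intro supported_on_mult supp)
  hence "residue_part 2 1 (\<f> 20 * G) = fps_X * (\<f> 20 * \<f> 20)"
    using supp(1) unfolding main
    by (intro fps_ext) (auto simp: residue_part_def supported_on_def mod_2_eq_odd elim!: oddE)
  hence "\<f> 20 * residue_part 2 1 G = \<f> 20 * (fps_X * \<f> 20)"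
    unfolding residue_part_mult[OF supp(2)] by (simp only: mult.left_commute)
  thus ?thesis
    using euler_prod_nonzero[of 20] by (simp add: G_def)
qed

lemma rd_series_3_3_nth_zero: "fps_nth (rd_series 3 3) (4 * n + 2) = 0"
proof -
  define G a b c where "G = rd_series 3 3" and "a = \<f> 1" and "b = \<f> 3" and "c = \<f> 9"
  have powers: "\<f> 2 = a ^ 2" "\<f> 4 = a ^ 4" "\<f> 6 = b ^ 2" "\<f> 12 = b ^ 4" "\<f> 36 = c ^ 4"
    using euler_prod_double[of 1] euler_prod_quadruple[of 1] euler_prod_double[of 3]
      euler_prod_quadruple[of 3] euler_prod_quadruple[of 9]
    by (simp_all add: a_def b_def c_def)
  have G: "G * a * c = b * b"
    using rd_series_euler_prod[of 3 3] by (simp add: G_def a_def b_def c_def)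
  have "a ^ 3 = b + fps_X * c ^ 3"
    unfolding a_def b_def c_def by (rule euler_prod_1_cube)
  hence Xc: "fps_X * c ^ 3 = a ^ 3 + b"
    by (simp add: add.commute add.left_commute)
  have ab: "a ^ 3 * b ^ 3 = \<f> 4 ^ 3 + fps_X * \<f> 12 ^ 3"
    unfolding a_def b_def by (rule euler_prod_cubes_1_3)
  \<comment> \<open>The extra q allows q c^3 to be replaced by a^3 + b; it also moves the exponents
    4n + 2 of G to 4n + 3.\<close>
  have "\<f> 4 * \<f> 36 * (fps_X * G) = (G * a * c) * a ^ 3 * (fps_X * c ^ 3)"
    unfolding powers by (simp only: power4_eq_xxxx power3_eq_cube ac_simps)
  also have "\<dots> = a ^ 6 * b ^ 2 + a ^ 3 * b ^ 3"
  proof -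
    have "a ^ 6 = a ^ 3 * a ^ 3" by (simp flip: power_add)
    thus ?thesis
      unfolding G Xc by (simp only: power2_eq_square power3_eq_cube distrib_left ac_simps)
  qed
  also have "a ^ 6 * b ^ 2 = \<f> 4 * \<f> 2 * \<f> 6"
    by (simp add: powers flip: power_add)
  finally have main: "\<f> 4 * \<f> 36 * (fps_X * G) = \<f> 4 * \<f> 2 * \<f> 6 + \<f> 4 ^ 3 + fps_X * \<f> 12 ^ 3"
    unfolding ab by (simp only: add.assoc)
  \<comment> \<open>Class 3 modulo 4 is missed by every term: the first two are even series and q
    f_12^3 has exponents 1 modulo 4.\<close>
  have "supported_on 2 (\<f> 4 * \<f> 2 * \<f> 6 + \<f> 4 ^ 3)"
    by (intro supported_on_add supported_on_mult supported_on_power supported_on_euler_prod) simp_all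
  moreover have "supported_on 4 (\<f> 12 ^ 3)"
    by (intro supported_on_power supported_on_euler_prod) simp_all
  ultimately have "residue_part 4 3 (\<f> 4 * \<f> 36 * (fps_X * G)) = 0"
    unfolding main
  proof (intro fps_ext)
    fix m
    assume s: "supported_on 2 (\<f> 4 * \<f> 2 * \<f> 6 + \<f> 4 ^ 3)" "supported_on 4 (\<f> 12 ^ 3)"
    show "fps_nth (residue_part 4 3 (\<f> 4 * \<f> 2 * \<f> 6 + \<f> 4 ^ 3 + fps_X * \<f> 12 ^ 3)) m = fps_nth 0 m"
    proof (cases "m mod 4 = 3")
      case True
      hence "\<not> 2 dvd m" "\<not> 4 dvd m - 1" "m \<noteq> 0" by presburger+
      thus ?thesis
        using s unfolding supported_on_def residue_part_def fps_nth_Abs_fps fps_add_nth[of "_ + _" "_ * _"]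
        by (simp del: fps_add_nth)
    qed (simp add: residue_part_def)
  qed
  moreover have supp: "supported_on 4 (\<f> 4 * \<f> 36)"
    by (intro supported_on_mult supported_on_euler_prod) simp_all
  moreover have "\<f> 4 * \<f> 36 \<noteq> 0"
    using euler_prod_nonzero[of 4] euler_prod_nonzero[of 36] by simp
  ultimately have "residue_part 4 3 (fps_X * G) = 0"
    by (simp add: residue_part_mult)
  hence "fps_nth (residue_part 4 3 (fps_X * G)) (Suc (4 * n + 2)) = 0"
    by simp
  moreover have "Suc (4 * n + 2) mod 4 = 3" by presburger
  ultimately show ?thesis
    unfolding residue_part_def fps_nth_Abs_fps by (simp add: G_def)
qed

section \<open>From the field with two elements back to congruences\<close>

lemma cong_mod_2_if_bit_eq:
  assumes "(of_int a :: bit) = of_int b"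
  shows "[a = b] (mod 2)"
proof -
  have "even (a - b)"
  proof (rule ccontr)
    assume "odd (a - b)"
    then obtain c where "a - b = 2 * c + 1" by (elim oddE)
    hence "of_int (a - b) = (of_int (2 * c + 1) :: bit)" by (simp only:)
    moreover have "of_int (a - b) = (0 :: bit)" using assms by simp
    moreover have "of_int (2 * c + 1) = (1 :: bit)"
      by (simp only: of_int_add of_int_mult of_int_numeral bit_2_eq_0 mult_zero_left add_0_left of_int_1)
    ultimately show False by simp
  qed
  thus ?thesis by (simp add: cong_iff_dvd_diff)
qed

lemma of_int_fps_nth_prod:
  fixes f :: "'b \<Rightarrow> int fps"
  shows "(of_int (fps_nth (\<Prod>i\<in>A. f i) n) :: 'a::comm_ring_1) =
    fps_nth (\<Prod>i\<in>A. Abs_fps (\<lambda>n. of_int (fps_nth (f i) n))) n"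
proof (induction A arbitrary: n rule: infinite_finite_induct)
  case (insert x A)
  thus ?case by (simp add: fps_mult_nth)
qed auto

text \<open>Coefficients are reduced modulo 2 only in a finite product; truncation after n + 1
  factors links it to the infinite products over the integers and over \<open>bit\<close>.\<close>

lemma of_int_euler_prod_nth:
  assumes "k > 0"
  shows "of_int (fps_nth (\<Prod>m. 1 - fps_X ^ (k * (m + 1)) :: int fps) n) = fps_nth (\<f> k) n"
proof -
  have "fps_nth (\<Prod>m. 1 - fps_X ^ (k * (m + 1)) :: int fps) n =
      fps_nth (\<Prod>m<Suc n. 1 - fps_X ^ (k * (m + 1)) :: int fps) n"
    by (intro fps_prodinf_nth eq_upto_add_X_power)
       (simp_all only: Suc_eq_plus1 [symmetric] lessI mult_Suc_ge[OF assms])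
  also have "of_int \<dots> = fps_nth (\<Prod>m<Suc n. 1 + fps_X ^ (k * Suc m) :: bit fps) n"
    unfolding of_int_fps_nth_prod
  proof (intro arg_cong[where f = "\<lambda>f. fps_nth f n"] prod.cong fps_ext)
    fix m j
    have "of_int (fps_nth (1 - fps_X ^ (k * (m + 1))) j) = fps_nth (1 - fps_X ^ (k * (m + 1)) :: bit fps) j"
      by (simp only: fps_sub_nth fps_one_nth fps_X_power_nth of_int_diff if_distrib[of of_int] of_int_0 of_int_1)
    thus "fps_nth (Abs_fps (\<lambda>n. of_int (fps_nth (1 - fps_X ^ (k * (m + 1))) n))) j =
        fps_nth (1 + fps_X ^ (k * Suc m) :: bit fps) j"
      by (simp only: fps_nth_Abs_fps bit_fps_diff Suc_eq_plus1)
  qed simp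
  also have "\<dots> = fps_nth (\<f> k) n"
    unfolding euler_prod_def by (rule fps_prodinf_nth[OF euler_factor_eq_upto[OF assms], symmetric]) simp
  finally show ?thesis .
qed

theorem theorem4:
  shows "(\<forall>n::nat. [p_RD 3 3 (4 * n + 2) = 0] (mod 2)) \<and>
         (\<forall>n::nat. [p_RD 2 5 (4 * n + 3) = 0] (mod 2)) \<and>
         (\<forall>n::nat. [fps_nth (Abs_fps (\<lambda>n. int (p_RD 2 5 (4 * n + 1)))) n =
                     fps_nth (\<Prod>m. 1 - fps_X ^ (5 * (m + 1)) :: int fps) n] (mod 2))"
proof (intro conjI allI)
  have cong_0: "[m = 0] (mod 2)" if "(of_nat m :: bit) = 0" for m
  proof -
    have "[int m = int 0] (mod int 2)"
      using cong_mod_2_if_bit_eq[of "int m" 0] that by simp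
    thus ?thesis by (simp only: cong_int_iff)
  qed
  have odd_nth: "(of_nat (p_RD 2 5 (Suc m)) :: bit) = fps_nth (\<f> 20) m" if "even m" for m
  proof -
    have "fps_nth (residue_part 2 1 (rd_series 2 5)) (Suc m) = fps_nth (fps_X * \<f> 20) (Suc m)"
      by (simp only: rd_series_2_5_odd_part)
    moreover have "Suc m mod 2 = 1" using that by presburger
    ultimately show ?thesis
      unfolding residue_part_def fps_nth_Abs_fps by (simp add: rd_series_nth)
  qed
  \<comment> \<open>Being f_5 at q^4, f_20 has no term at 4n + 2, which gives (b), and its term at
    4n is the coefficient of q^n in f_5, which gives (c).\<close>
  have "\<f> 20 = \<f> 5 oo fps_X ^ 4"
    by (simp add: euler_prod_compose)
  hence f20: "fps_nth (\<f> 20) m = (if 4 dvd m then fps_nth (\<f> 5) (m div 4) else 0)" for m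
    by (simp only: fps_nth_compose_X_power)
  fix n :: nat
  show "[p_RD 3 3 (4 * n + 2) = 0] (mod 2)"
    using rd_series_3_3_nth_zero[of n] by (intro cong_0) (simp only: rd_series_nth zero_less_numeral)
  have "\<not> 4 dvd 4 * n + 2" by presburger
  hence "fps_nth (\<f> 20) (4 * n + 2) = 0"
    by (simp only: f20 if_False)
  moreover have "4 * n + 3 = Suc (4 * n + 2)" by simp
  ultimately show "[p_RD 2 5 (4 * n + 3) = 0] (mod 2)"
    using odd_nth[of "4 * n + 2"] by (intro cong_0) (simp only: even_add even_mult_iff even_numeral simp_thms)
  have "(of_nat (p_RD 2 5 (4 * n + 1)) :: bit) = fps_nth (\<f> 5) n"
    using odd_nth[of "4 * n"] f20[of "4 * n"] by (simp add: Suc_eq_plus1)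
  thus "[fps_nth (Abs_fps (\<lambda>n. int (p_RD 2 5 (4 * n + 1)))) n =
      fps_nth (\<Prod>m. 1 - fps_X ^ (5 * (m + 1)) :: int fps) n] (mod 2)"
    using of_int_euler_prod_nth[of 5 n] by (intro cong_mod_2_if_bit_eq) simp
qed

end
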